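(* Let $\mathbb{U}$ be the Urysohn universal metric space and let $\mathrm{Iso}(\mathbb{U})$ be the group of all isometries of $\mathbb{U}$ onto itself, equipped with its standard Polish topology (the topology of pointwise convergence on $\mathbb{U}$). Then $\mathrm{Iso}(\mathbb{U})$ is a Lévy group. Moreover, the compact subgroups $G_1<G_2<\dots<G_n<\dots$ forming the approximating Lévy family in the definition of a Lévy group can be chosen to be finite.
   Context: The Urysohn metric space $\mathbb{U}$ is the (unique up to isometry) metric space such that: (1) $\mathbb{U}$ is a complete separable metric space; (2) $\mathbb{U}$ is ultrahomogeneous, that is, every isometry between two finite metric subspaces of $\mathbb{U}$ extends to a global isometry of $\mathbb{U}$ onto itself; (3) $\mathbb{U}$ contains an isometric copy of every separable metric space. An $mm$-space is a triple $(X,d,\mu)$ consisting of a set $X$, a metric $d$ on $X$, and a Borel probability measure $\mu$ on the metric space $(X,d)$. For $A\subseteq X$ and $\varepsilon>0$, $A_\varepsilon$ denotes the $\varepsilon$-neighbourhood of $A$ in $X$. A family $(X_n,d_n,\mu_n)_{n\in\mathbb{N}}$ of $mm$-spaces is a Lévy family if, whenever Borel subsets $A_n\subseteq X_n$ satisfy $\liminf_{n\to\infty}\mu_n(A_n)>0$, one has $\lim_{n\to\infty}\mu_n((A_n)_\varepsilon)=1$ for every $\varepsilon>0$. A metrizable topological group $G$ is a Lévy group if it contains an increasing chain of compact subgroups $G_1<G_2<\dots<G_n<\dots$ having an everywhere dense union in $G$ and such that, for some right-invariant compatible metric $d$ on $G$, the groups $G_n$, equipped with the normalized Haar measures and the restrictions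 of the metric $d$, form a Lévy family. *)

theory Defs
  imports "HOL-Algebra.Coset" "HOL-Probability.Probability_Measure"
begin

section \<open>The Urysohn space and its isometry group\<close>

definition isometric_on :: "'a::metric_space set \<Rightarrow> ('a \<Rightarrow> 'a) \<Rightarrow> bool" where
  "isometric_on A f \<longleftrightarrow> (\<forall>x\<in>A. \<forall>y\<in>A. dist (f x) (f y) = dist x y)"

definition isometries :: "('a::metric_space \<Rightarrow> 'a) set" where
  "isometries = {f. isometric_on UNIV f \<and> surj f}"

definition ultrahomogeneous :: "'a::metric_space itself \<Rightarrow> bool" where
  "ultrahomogeneous (_ :: 'a itself) \<longleftrightarrow>
     (\<forall>A (f :: 'a \<Rightarrow> 'a). finite A \<and> isometric_on A f \<longrightarrow>
        (\<exists>g\<in>isometries. \<forall>x\<in>A. g x = f x))"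

text \<open>
  HOL cannot quantify over all types inside a formula.  A separable metric space has at most
  the cardinality of the continuum, hence is isometric to one whose carrier is a set of reals;
  it therefore loses nothing to let \<open>(M, m)\<close> range over all separable metric spaces with carrier
  \<open>M :: real set\<close>.  The metric \<open>m\<close> is arbitrary and unrelated to the usual one on the reals.
\<close>

definition universal_separable :: "'a::metric_space itself \<Rightarrow> bool" where
  "universal_separable (_ :: 'a itself) \<longleftrightarrow>
     (\<forall>(M :: real set) m. Metric_space M m \<and> separable_space (Metric_space.mtopology M m) \<longrightarrow>
        (\<exists>f :: real \<Rightarrow> 'a. \<forall>x\<in>M. \<forall>y\<in>M. dist (f x) (f y) = m x y))"

definition urysohn_space :: "'a::metric_space itself \<Rightarrow> bool" where
  "urysohn_space (_ :: 'a itself) \<longleftrightarrow>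
     complete (UNIV :: 'a set) \<and> separable_space (euclidean :: 'a topology) \<and>
     ultrahomogeneous TYPE('a) \<and> universal_separable TYPE('a)"

definition Iso :: "('a::metric_space \<Rightarrow> 'a) monoid" where
  "Iso = \<lparr>carrier = isometries, monoid.mult = (\<circ>), one = id\<rparr>"

definition pointwise_topology :: "('a::metric_space \<Rightarrow> 'a) topology" where
  "pointwise_topology = subtopology (product_topology (\<lambda>_. euclidean) UNIV) isometries"


section \<open>Levy families\<close>

definition borel_sets_of :: "'a topology \<Rightarrow> 'a set set" where
  "borel_sets_of T = sigma_sets (topspace T) {U. openin T U}"

definition mm_space :: "'a set \<Rightarrow> ('a \<Rightarrow> 'a \<Rightarrow> real) \<Rightarrow> 'a measure \<Rightarrow> bool" where
  "mm_space X d \<mu> \<longleftrightarrow>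
     Metric_space X d \<and> prob_space \<mu> \<and> space \<mu> = X \<and>
     sets \<mu> = borel_sets_of (Metric_space.mtopology X d)"

definition nbhd :: "'a set \<Rightarrow> ('a \<Rightarrow> 'a \<Rightarrow> real) \<Rightarrow> 'a set \<Rightarrow> real \<Rightarrow> 'a set" where
  "nbhd X d A \<epsilon> = {x\<in>X. \<exists>a\<in>A. d x a < \<epsilon>}"

definition levy_family ::
  "(nat \<Rightarrow> 'a set) \<Rightarrow> (nat \<Rightarrow> 'a \<Rightarrow> 'a \<Rightarrow> real) \<Rightarrow> (nat \<Rightarrow> 'a measure) \<Rightarrow> bool" where
  "levy_family X d \<mu> \<longleftrightarrow>
     (\<forall>n. mm_space (X n) (d n) (\<mu> n)) \<and>
     (\<forall>A. (\<forall>n. A n \<in> sets (\<mu> n)) \<and> liminf (\<lambda>n. emeasure (\<mu> n) (A n)) > 0 \<longrightarrow>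
        (\<forall>\<epsilon>>0. (\<lambda>n. measure (\<mu> n) (nbhd (X n) (d n) (A n) \<epsilon>)) \<longlonglongrightarrow> 1))"


section \<open>Levy groups\<close>

definition topological_group :: "('a, 'b) monoid_scheme \<Rightarrow> 'a topology \<Rightarrow> bool" where
  "topological_group G T \<longleftrightarrow>
     group G \<and> topspace T = carrier G \<and>
     continuous_map (prod_topology T T) T (\<lambda>(x, y). x \<otimes>\<^bsub>G\<^esub> y) \<and>
     continuous_map T T (\<lambda>x. inv\<^bsub>G\<^esub> x)"

text \<open>
  The normalized Haar measure of a compact Hausdorff group: the (unique) left-invariant
  regular Borel probability measure.
\<close>

definition normalized_haar_measure ::
  "('a, 'b) monoid_scheme \<Rightarrow> 'a topology \<Rightarrow> 'a measure \<Rightarrow> bool" where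
  "normalized_haar_measure K T \<mu> \<longleftrightarrow>
     prob_space \<mu> \<and> space \<mu> = carrier K \<and> sets \<mu> = borel_sets_of T \<and>
     (\<forall>g\<in>carrier K. \<forall>A\<in>sets \<mu>. emeasure \<mu> (g <#\<^bsub>K\<^esub> A) = emeasure \<mu> A) \<and>
     (\<forall>A\<in>sets \<mu>. emeasure \<mu> A = (SUP C\<in>{C. compactin T C \<and> C \<subseteq> A}. emeasure \<mu> C))"

definition right_invariant_compatible_metric ::
  "('a, 'b) monoid_scheme \<Rightarrow> 'a topology \<Rightarrow> ('a \<Rightarrow> 'a \<Rightarrow> real) \<Rightarrow> bool" where
  "right_invariant_compatible_metric G T d \<longleftrightarrow>
     Metric_space (carrier G) d \<and> Metric_space.mtopology (carrier G) d = T \<and>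
     (\<forall>x\<in>carrier G. \<forall>y\<in>carrier G. \<forall>g\<in>carrier G. d (x \<otimes>\<^bsub>G\<^esub> g) (y \<otimes>\<^bsub>G\<^esub> g) = d x y)"

text \<open>
  The sequence \<open>H\<close> of subgroups is the approximating family required of a Levy group;
  the chain is taken to be strictly increasing.
\<close>

definition levy_chain ::
  "('a, 'b) monoid_scheme \<Rightarrow> 'a topology \<Rightarrow> (nat \<Rightarrow> 'a set) \<Rightarrow> bool" where
  "levy_chain G T H \<longleftrightarrow>
     (\<forall>n. subgroup (H n) G \<and> compactin T (H n) \<and> H n \<subset> H (Suc n)) \<and>
     T closure_of (\<Union>n. H n) = topspace T \<and>
     (\<exists>d \<mu>. right_invariant_compatible_metric G T d \<and>
        (\<forall>n. normalized_haar_measure (G\<lparr>carrier := H n\<rparr>) (subtopology T (H n)) (\<mu> n)) \<and>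
        levy_family H (\<lambda>_. d) \<mu>)"

definition levy_group :: "('a, 'b) monoid_scheme \<Rightarrow> 'a topology \<Rightarrow> bool" where
  "levy_group G T \<longleftrightarrow>
     topological_group G T \<and> metrizable_space T \<and> (\<exists>H. levy_chain G T H)"

end

theory Submission
  imports Defs "HOL-Analysis.Function_Metric"
begin

text \<open>
  The approximating groups come from finite groups \<open>G\<close> of isometries of finite subsets \<open>X\<close> of the
  Urysohn space. Such a pair is enlarged to a pair \<open>(Y, H)\<close> with \<open>X \<subseteq> Y\<close> and an embedding of \<open>G\<close> into
  \<open>H\<close> that extends the action on \<open>X\<close>. By universality and ultrahomogeneity it suffices to describe \<open>Y\<close>
  abstractly, as a finite pseudometric space that contains an equivariant copy of \<open>X\<close>
  (\<open>realize_action\<close>). Two enlargements are used.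

  Approximation (\<open>realize_partial_isometry\<close>): for a given partial isometry \<open>p\<close> between finite sets and
  \<open>\<delta> > 0\<close>, the new group contains an element that agrees with \<open>p\<close> up to \<open>\<delta>\<close>. Points are represented by
  families of 1-Lipschitz functions indexed by a finite set \<open>S\<close>, on which all permutations of \<open>S\<close> act by
  isometries. The index set is a truncated tree of reduced words in the free product of \<open>G\<close> and
  a group of order two, and the functions are distance functions carried along these words. They
  lose \<open>\<delta>\<close> at every step and therefore have become zero at the truncation depth, so that cutting the
  tree causes no inconsistency. Being allowed an error \<open>\<delta>\<close> is what makes the finite tree possible.

  Concentration (\<open>realize_power\<close>): the power \<open>G\<^sup>n\<close> acts on \<open>X\<^sup>n\<close> with the averaged distance, and \<open>X\<close> is the
  diagonal. Displacements of diagonal points are controlled by the normalized Hamming distance on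
  \<open>G\<^sup>n\<close>, which concentrates as \<open>n\<close> grows, uniformly in \<open>G\<close> (\<open>concentration_words\<close>).

  Alternating the two steps along a dense sequence of points and a dense sequence of isometries
  gives a tower of finite actions whose underlying sets have dense union. Every group in the tower
  then acts on the completion of this union, that is, on the whole Urysohn space
  (\<open>isometry_tower\<close>), and the groups become an increasing chain of finite subgroups of the isometry
  group. The approximations make the union of the chain dense. The concentration at step \<open>k\<close> concerns
  the displacement of the first \<open>k\<close> points of the dense sequence; since the right-invariant metric
  is governed by finitely many of these points up to any given error, the chain is a Levy family.
\<close>

section \<open>Finite group actions in the Urysohn space\<close>

text \<open>
  Finite configurations to be placed in the Urysohn space are given as pseudometrics, so that
  points are identified by putting them at distance zero instead of by forming a quotient.
\<close>

definition pseudometric_on :: "'z set \<Rightarrow> ('z \<Rightarrow> 'z \<Rightarrow> real) \<Rightarrow> bool" where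
  "pseudometric_on Z \<rho> \<longleftrightarrow>
     (\<forall>x\<in>Z. \<rho> x x = 0) \<and> (\<forall>x\<in>Z. \<forall>y\<in>Z. 0 \<le> \<rho> x y \<and> \<rho> x y = \<rho> y x) \<and>
     (\<forall>x\<in>Z. \<forall>y\<in>Z. \<forall>z\<in>Z. \<rho> x z \<le> \<rho> x y + \<rho> y z)"

lemma isometric_onD: "isometric_on A f \<Longrightarrow> x \<in> A \<Longrightarrow> y \<in> A \<Longrightarrow> dist (f x) (f y) = dist x y"
  by (simp add: isometric_on_def)

lemma isometric_on_inj: "isometric_on A f \<Longrightarrow> inj_on f A"
  unfolding inj_on_def isometric_on_def by (metis dist_eq_0_iff)

lemma finite_diameter_bound:
  fixes X :: "'u::metric_space set"
  assumes "finite X" obtains D where "0 \<le> D" "\<And>x y. x \<in> X \<Longrightarrow> y \<in> X \<Longrightarrow> dist x y \<le> D"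
proof (rule that[of "Max (insert 0 ((\<lambda>(x, y). dist x y) ` (X \<times> X)))"])
  show "0 \<le> Max (insert 0 ((\<lambda>(x, y). dist x y) ` (X \<times> X)))" using assms by (intro Max_ge) auto
  show "dist x y \<le> Max (insert 0 ((\<lambda>(x, y). dist x y) ` (X \<times> X)))" if "x \<in> X" "y \<in> X" for x y
    using assms that by (intro Max_ge) auto
qed

text \<open>
  Universality applies to metrics on sets of reals. The quotient of \<open>Z\<close> by the relation
  \<open>\<rho> x y = 0\<close> becomes such a set: each class is represented by a chosen element, and the
  representatives are numbered.
\<close>

lemma finite_pseudometric_embeds:
  fixes \<rho> :: "'z \<Rightarrow> 'z \<Rightarrow> real"
  assumes U: "urysohn_space TYPE('u::metric_space)"
    and fin: "finite Z" and pm: "pseudometric_on Z \<rho>"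
  shows "\<exists>f :: 'z \<Rightarrow> 'u. \<forall>x\<in>Z. \<forall>y\<in>Z. dist (f x) (f y) = \<rho> x y"
proof -
  have refl: "\<rho> x x = 0" if "x \<in> Z" for x using pm that by (simp add: pseudometric_on_def)
  have pos: "0 \<le> \<rho> x y" and sym: "\<rho> x y = \<rho> y x" if "x \<in> Z" "y \<in> Z" for x y
    using pm that by (auto simp: pseudometric_on_def)
  have tri: "\<rho> x z \<le> \<rho> x y + \<rho> y z" if "x \<in> Z" "y \<in> Z" "z \<in> Z" for x y z
    using pm that by (simp add: pseudometric_on_def)
  define r where "r z = (SOME z'. z' \<in> Z \<and> \<rho> z z' = 0)" for z
  have r: "r z \<in> Z \<and> \<rho> z (r z) = 0" if "z \<in> Z" for z
    unfolding r_def by (rule someI[of _ z]) (simp add: that refl)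
  have eq0: "\<rho> x z = \<rho> y z" if "x \<in> Z" "y \<in> Z" "z \<in> Z" "\<rho> x y = 0" for x y z
    using tri[of x y z] tri[of y x z] sym[of x y] that by simp
  have rr: "r x = r y" if "x \<in> Z" "y \<in> Z" "\<rho> x y = 0" for x y
  proof -
    have "(\<lambda>z'. z' \<in> Z \<and> \<rho> x z' = 0) = (\<lambda>z'. z' \<in> Z \<and> \<rho> y z' = 0)"
      using eq0[OF that(1,2) _ that(3)] by auto
    thus ?thesis unfolding r_def by simp
  qed
  have \<rho>r: "\<rho> (r x) (r y) = \<rho> x y" if "x \<in> Z" "y \<in> Z" for x y
    using eq0[of x "r x" "r y"] eq0[of y "r y" x] r[OF that(1)] r[OF that(2)] that sym by metis
  obtain i :: "'z \<Rightarrow> nat" where i: "inj_on i Z"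
    using finite_imp_inj_to_nat_seg[OF fin] by blast
  define enc where "enc z = real (i (r z))" for z
  define M where "M = enc ` Z"
  define m where "m a b = (if a \<in> M \<and> b \<in> M then \<rho> (inv_into Z enc a) (inv_into Z enc b) else 0)" for a b
  have m_enc: "m (enc x) (enc y) = \<rho> x y" if "x \<in> Z" "y \<in> Z" for x y
  proof -
    have *: "inv_into Z enc (enc z) \<in> Z \<and> r (inv_into Z enc (enc z)) = r z" if "z \<in> Z" for z
    proof -
      have a: "inv_into Z enc (enc z) \<in> Z" using that by (simp add: inv_into_into)
      have "enc (inv_into Z enc (enc z)) = enc z" using that by (simp add: f_inv_into_f)
      hence "i (r (inv_into Z enc (enc z))) = i (r z)" by (simp add: enc_def)
      thus ?thesis using a i r that by (auto dest: inj_onD)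
    qed
    have "m (enc x) (enc y) = \<rho> (inv_into Z enc (enc x)) (inv_into Z enc (enc y))"
      using that by (simp add: m_def M_def)
    also have "\<dots> = \<rho> x y" using \<rho>r * that by metis
    finally show ?thesis .
  qed
  have MS: "Metric_space M m"
  proof
    have dec: "inv_into Z enc a \<in> Z" if "a \<in> M" for a
      using that unfolding M_def by (rule inv_into_into)
    show "0 \<le> m x y" for x y unfolding m_def using pos[OF dec dec] by simp
    show "m x y = m y x" for x y unfolding m_def using sym[OF dec dec, of x y] by simp
    show "m x y = 0 \<longleftrightarrow> x = y" if xy: "x \<in> M" "y \<in> M" for x y
    proof -
      obtain a b where ab: "x = enc a" "y = enc b" "a \<in> Z" "b \<in> Z" using xy by (auto simp: M_def)
      have "enc a = enc b" if "\<rho> a b = 0"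
        using rr[OF ab(3,4) that] by (simp add: enc_def)
      moreover have "m x y = \<rho> a b" using m_enc ab by simp
      moreover have "m (enc a) (enc a) = 0" using m_enc[of a a] refl[of a] ab by simp
      ultimately show ?thesis using ab by metis
    qed
    show "m x z \<le> m x y + m y z" if xyz: "x \<in> M" "y \<in> M" "z \<in> M" for x y z
    proof -
      obtain a b c where abc: "x = enc a" "y = enc b" "z = enc c" "a \<in> Z" "b \<in> Z" "c \<in> Z"
        using xyz by (auto simp: M_def)
      show ?thesis using tri[of a b c] abc m_enc by simp
    qed
  qed
  have "separable_space (Metric_space.mtopology M m)"
    proof -
    have M: "countable M" "topspace (Metric_space.mtopology M m) = M"
      using fin MS by (auto simp: M_def countable_finite Metric_space.topspace_mtopology)
    show ?thesis unfolding separable_space_def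
      using M closure_of_topspace[of "Metric_space.mtopology M m"]
      by (intro exI[of _ M]) simp
  qed
  with MS obtain f :: "real \<Rightarrow> 'u" where f: "\<forall>x\<in>M. \<forall>y\<in>M. dist (f x) (f y) = m x y"
    using U unfolding urysohn_space_def universal_separable_def by blast
  show ?thesis
    by (rule exI[of _ "\<lambda>z. f (enc z)"]) (use f m_enc in \<open>auto simp: M_def\<close>)
qed

text \<open>
  The points \<open>\<iota> ` X\<close> may be prescribed in advance: an arbitrary embedding restricted to them is a
  partial isometry onto its image, and ultrahomogeneity provides a global isometry which moves
  this image back to \<open>X\<close>.
\<close>

lemma finite_pseudometric_extends:
  fixes \<rho> :: "'z \<Rightarrow> 'z \<Rightarrow> real" and \<iota> :: "'u::metric_space \<Rightarrow> 'z"
  assumes U: "urysohn_space TYPE('u)"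
    and fin: "finite Z" and pm: "pseudometric_on Z \<rho>"
    and X: "finite X" "\<iota> ` X \<subseteq> Z" "\<And>x y. x \<in> X \<Longrightarrow> y \<in> X \<Longrightarrow> \<rho> (\<iota> x) (\<iota> y) = dist x y"
  shows "\<exists>\<phi> :: 'z \<Rightarrow> 'u. (\<forall>z\<in>Z. \<forall>z'\<in>Z. dist (\<phi> z) (\<phi> z') = \<rho> z z') \<and> (\<forall>x\<in>X. \<phi> (\<iota> x) = x)"
proof -
  obtain f :: "'z \<Rightarrow> 'u" where f: "\<forall>x\<in>Z. \<forall>y\<in>Z. dist (f x) (f y) = \<rho> x y"
    using finite_pseudometric_embeds[OF U fin pm] by blast
  define j where "j = f \<circ> \<iota>"
  have jd: "isometric_on X j"
    using f X by (auto simp: isometric_on_def j_def image_subset_iff)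
  hence "inj_on j X" by (rule isometric_on_inj)
  hence p: "inv_into X j (j x) = x" if "x \<in> X" for x using that by simp
  have "isometric_on (j ` X) (inv_into X j)"
    using jd p by (simp add: isometric_on_def)
  moreover have "finite (j ` X)" using X by simp
  ultimately obtain g where g: "g \<in> isometries" "\<forall>x\<in>j ` X. g x = inv_into X j x"
    using U unfolding urysohn_space_def ultrahomogeneous_def by blast
  have iso: "dist (g x) (g y) = dist x y" for x y
    using g(1) by (simp add: isometries_def isometric_on_def)
  show ?thesis
  proof (intro exI[of _ "g \<circ> f"] conjI ballI)
    show "dist ((g \<circ> f) z) ((g \<circ> f) w) = \<rho> z w" if "z \<in> Z" "w \<in> Z" for z w
      using f iso that by simp
    show "(g \<circ> f) (\<iota> x) = x" if "x \<in> X" for x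
      using g(2) p that by (simp add: j_def)
  qed
qed

text \<open>
  A group acting on \<open>X\<close> is kept as a set of maps of the whole space which are the identity
  off \<open>X\<close>. Such a map is determined by its restriction to \<open>X\<close>, so the action is faithful, and
  closure under inverses follows from finiteness.
\<close>

definition finite_isometry_group :: "'u::metric_space set \<Rightarrow> ('u \<Rightarrow> 'u) set \<Rightarrow> bool" where
  "finite_isometry_group X G \<longleftrightarrow> finite X \<and> id \<in> G \<and> (\<forall>g\<in>G. \<forall>h\<in>G. g \<circ> h \<in> G) \<and>
     (\<forall>g\<in>G. g ` X \<subseteq> X \<and> isometric_on X g \<and> (\<forall>x. x \<notin> X \<longrightarrow> g x = x))"

text \<open>
  The embedding \<open>e\<close> is not an inclusion: \<open>g\<close> fixes the points of \<open>Y - X\<close>, while its counterpart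
  in \<open>H\<close> moves them.
\<close>

definition group_extension ::
  "'u::metric_space set \<Rightarrow> ('u \<Rightarrow> 'u) set \<Rightarrow> 'u set \<Rightarrow> ('u \<Rightarrow> 'u) set \<Rightarrow> (('u \<Rightarrow> 'u) \<Rightarrow> ('u \<Rightarrow> 'u)) \<Rightarrow> bool" where
  "group_extension X G Y H e \<longleftrightarrow> X \<subseteq> Y \<and> (\<forall>g\<in>G. e g \<in> H \<and> (\<forall>x\<in>X. e g x = g x)) \<and>
     (\<forall>g\<in>G. \<forall>h\<in>G. e (g \<circ> h) = e g \<circ> e h)"

lemma finite_isometry_groupD:
  assumes "finite_isometry_group X G"
  shows "finite X" "id \<in> G" "g \<in> G \<Longrightarrow> h \<in> G \<Longrightarrow> g \<circ> h \<in> G" "g \<in> G \<Longrightarrow> x \<in> X \<Longrightarrow> g x \<in> X"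
    "g \<in> G \<Longrightarrow> isometric_on X g" "g \<in> G \<Longrightarrow> x \<notin> X \<Longrightarrow> g x = x"
proof -
  note def = assms[unfolded finite_isometry_group_def]
  note * = def[THEN conjunct1] def[THEN conjunct2, THEN conjunct2, THEN conjunct1]
    def[THEN conjunct2, THEN conjunct2, THEN conjunct2]
  show "finite X" "id \<in> G" by (rule def[THEN conjunct1], rule def[THEN conjunct2, THEN conjunct1])
  show "g \<circ> h \<in> G" if "g \<in> G" "h \<in> G"
    using *(2)[THEN bspec, OF that(1), THEN bspec, OF that(2)] .
  show "g x \<in> X" if "g \<in> G" "x \<in> X"
    using *(3)[THEN bspec, OF that(1)] that(2) by (simp add: image_subset_iff)
  show "isometric_on X g" if "g \<in> G" using *(3)[THEN bspec, OF that] by simp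
  show "g x = x" if "g \<in> G" "x \<notin> X" using *(3)[THEN bspec, OF that(1)] that(2) by simp
qed

lemma finite_isometry_group_permutes:
  assumes G: "finite_isometry_group X G" and g: "g \<in> G"
  shows "g permutes X"
proof (rule bij_imp_permutes)
  have "inj_on g X" using G g by (simp add: finite_isometry_groupD(5) isometric_on_inj)
  moreover have "g ` X \<subseteq> X" using finite_isometry_groupD(4)[OF G g] by (rule image_subsetI)
  moreover have "finite X" using G by (rule finite_isometry_groupD)
  ultimately show "bij_betw g X X" unfolding bij_betw_def by (simp add: endo_inj_surj)
qed (use G g in \<open>simp add: finite_isometry_group_def\<close>)

lemma finite_isometry_group_finite:
  assumes "finite_isometry_group X G" shows "finite G"
proof (rule finite_subset)
  show "G \<subseteq> {g. g permutes X}" using finite_isometry_group_permutes[OF assms] by blast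
  show "finite {g. g permutes X}" using assms by (simp add: finite_isometry_group_def finite_permutations)
qed

lemma finite_isometry_group_inverse:
  assumes G: "finite_isometry_group X G" and g: "g \<in> G"
  obtains h where "h \<in> G" "g \<circ> h = id" "h \<circ> g = id"
proof -
  have "inj g" using finite_isometry_group_permutes[OF G g] by (rule permutes_inj)
  hence "inj_on ((\<circ>) g) G" by (auto simp: inj_on_def fun_eq_iff)
  moreover have "(\<circ>) g ` G \<subseteq> G" using G g by (auto simp: finite_isometry_group_def)
  ultimately have "(\<circ>) g ` G = G" using finite_isometry_group_finite[OF G] by (simp add: endo_inj_surj)
  hence "id \<in> (\<circ>) g ` G" using finite_isometry_groupD(2)[OF G] by simp
  then obtain h where h: "id = g \<circ> h" "h \<in> G" by (rule imageE)
  note h = h(2) h(1)[symmetric]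
  have "surj g" using finite_isometry_group_permutes[OF G g] by (rule permutes_surj)
  have "h \<circ> g = id"
  proof
    fix x
    have "g (h (g x)) = g x" using h(2) by (metis comp_apply id_apply)
    thus "(h \<circ> g) x = id x" using \<open>inj g\<close> by (simp add: inj_eq)
  qed
  with h show ?thesis using that by blast
qed

lemma group_extension_trans:
  assumes "group_extension X G Y H e" "group_extension Y H Z K e'"
    and "finite_isometry_group X G"
  shows "group_extension X G Z K (e' \<circ> e)"
  using assms unfolding group_extension_def finite_isometry_group_def
  by (auto simp: subset_iff)

text \<open>
  An action on an abstract finite pseudometric space \<open>Z\<close> that contains an equivariant copy of \<open>X\<close>
  is transported to the Urysohn space along an embedding \<open>\<phi>\<close> which is the identity on \<open>X'\<close>. Points
  at distance zero stay at distance zero under the action, so it descends to the image of \<open>\<phi>\<close>.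
  All later enlargements of a finite group are obtained by choosing a suitable \<open>Z\<close>.
\<close>

lemma realize_action:
  fixes \<rho> :: "'z \<Rightarrow> 'z \<Rightarrow> real" and \<iota> :: "'u::metric_space \<Rightarrow> 'z"
    and act :: "'k \<Rightarrow> 'z \<Rightarrow> 'z" and mul :: "'k \<Rightarrow> 'k \<Rightarrow> 'k"
  assumes U: "urysohn_space TYPE('u)"
    and fin: "finite Z" and pm: "pseudometric_on Z \<rho>"
    and G: "finite_isometry_group X G" and XX': "X \<subseteq> X'" "finite X'"
    and \<iota>: "\<iota> ` X' \<subseteq> Z" "\<And>x y. x \<in> X' \<Longrightarrow> y \<in> X' \<Longrightarrow> \<rho> (\<iota> x) (\<iota> y) = dist x y"
    and unt: "unt \<in> K" "\<And>z. z \<in> Z \<Longrightarrow> act unt z = z"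
    and mul: "\<And>k l. k \<in> K \<Longrightarrow> l \<in> K \<Longrightarrow> mul k l \<in> K"
      "\<And>k l z. k \<in> K \<Longrightarrow> l \<in> K \<Longrightarrow> z \<in> Z \<Longrightarrow> act (mul k l) z = act k (act l z)"
    and act: "\<And>k z. k \<in> K \<Longrightarrow> z \<in> Z \<Longrightarrow> act k z \<in> Z"
      "\<And>k z w. k \<in> K \<Longrightarrow> z \<in> Z \<Longrightarrow> w \<in> Z \<Longrightarrow> \<rho> (act k z) (act k w) = \<rho> z w"
    and \<theta>: "\<And>g. g \<in> G \<Longrightarrow> \<theta> g \<in> K"
      "\<And>g h. g \<in> G \<Longrightarrow> h \<in> G \<Longrightarrow> \<theta> (g \<circ> h) = mul (\<theta> g) (\<theta> h)"
      "\<And>g x. g \<in> G \<Longrightarrow> x \<in> X \<Longrightarrow> \<rho> (act (\<theta> g) (\<iota> x)) (\<iota> (g x)) = 0"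
  obtains Y H e \<phi> \<pi> where "finite_isometry_group Y H" "X' \<subseteq> Y" "group_extension X G Y H e"
    "\<phi> ` Z = Y" "\<And>z w. z \<in> Z \<Longrightarrow> w \<in> Z \<Longrightarrow> dist (\<phi> z) (\<phi> w) = \<rho> z w"
    "\<And>x. x \<in> X' \<Longrightarrow> \<phi> (\<iota> x) = x" "\<pi> ` K = H"
    "\<And>k z. k \<in> K \<Longrightarrow> z \<in> Z \<Longrightarrow> \<pi> k (\<phi> z) = \<phi> (act k z)"
    "\<And>g. g \<in> G \<Longrightarrow> e g = \<pi> (\<theta> g)"
proof -
  have "\<exists>\<phi> :: 'z \<Rightarrow> 'u. (\<forall>z\<in>Z. \<forall>w\<in>Z. dist (\<phi> z) (\<phi> w) = \<rho> z w) \<and> (\<forall>x\<in>X'. \<phi> (\<iota> x) = x)"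
    by (rule finite_pseudometric_extends[OF U fin pm XX'(2) \<iota>])
  then obtain \<phi> :: "'z \<Rightarrow> 'u" where "\<forall>z\<in>Z. \<forall>w\<in>Z. dist (\<phi> z) (\<phi> w) = \<rho> z w"
    "\<forall>x\<in>X'. \<phi> (\<iota> x) = x" by (elim exE conjE)
  hence \<phi>: "\<And>z w. z \<in> Z \<Longrightarrow> w \<in> Z \<Longrightarrow> dist (\<phi> z) (\<phi> w) = \<rho> z w"
    "\<And>x. x \<in> X' \<Longrightarrow> \<phi> (\<iota> x) = x" by simp_all
  define Y where "Y = \<phi> ` Z"
  define \<pi> where "\<pi> k y = (if y \<in> Y then \<phi> (act k (inv_into Z \<phi> y)) else y)" for k y
  have \<pi>: "\<pi> k (\<phi> z) = \<phi> (act k z)" if "k \<in> K" "z \<in> Z" for k z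
  proof -
    let ?w = "inv_into Z \<phi> (\<phi> z)"
    have w: "?w \<in> Z" "\<phi> ?w = \<phi> z" using that by (auto simp: inv_into_into f_inv_into_f)
    hence "\<rho> ?w z = 0" using \<phi>(1)[of ?w z] that by simp
    hence "dist (\<phi> (act k ?w)) (\<phi> (act k z)) = 0"
      using act w that \<phi>(1) by simp
    thus ?thesis using that by (simp add: \<pi>_def Y_def)
  qed
  have \<pi>out: "\<pi> k y = y" if "y \<notin> Y" for k y using that by (simp add: \<pi>_def)
  have \<pi>mul: "\<pi> (mul k l) = \<pi> k \<circ> \<pi> l" if "k \<in> K" "l \<in> K" for k l
  proof
    fix y show "\<pi> (mul k l) y = (\<pi> k \<circ> \<pi> l) y"
      by (cases "y \<in> Y") (auto simp: Y_def \<pi> \<pi>out that mul act)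
  qed
  have \<pi>unt: "\<pi> unt = id"
  proof
    fix y show "\<pi> unt y = id y"
      by (cases "y \<in> Y") (auto simp: Y_def \<pi> \<pi>out unt)
  qed
  have H: "finite_isometry_group Y (\<pi> ` K)"
    unfolding finite_isometry_group_def
  proof (intro conjI ballI)
    show "finite Y" using fin by (simp add: Y_def)
    show "id \<in> \<pi> ` K" using \<pi>unt unt by (metis imageI)
    show "g \<circ> h \<in> \<pi> ` K" if "g \<in> \<pi> ` K" "h \<in> \<pi> ` K" for g h
      using that \<pi>mul mul by (metis (no_types, lifting) image_iff)
    show "g ` Y \<subseteq> Y" if "g \<in> \<pi> ` K" for g using that \<pi> act by (auto simp: Y_def)
    show "isometric_on Y g" if "g \<in> \<pi> ` K" for g
      using that \<pi> act \<phi> by (auto simp: Y_def isometric_on_def)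
    show "\<forall>x. x \<notin> Y \<longrightarrow> g x = x" if "g \<in> \<pi> ` K" for g
      using that \<pi>out by auto
  qed
  have XY: "X' \<subseteq> Y" using \<iota> \<phi>(2) by (force simp: Y_def)
  have E: "group_extension X G Y (\<pi> ` K) (\<pi> \<circ> \<theta>)"
    unfolding group_extension_def
  proof (intro conjI ballI)
    show "X \<subseteq> Y" using XX' XY by blast
    show "(\<pi> \<circ> \<theta>) g \<in> \<pi> ` K" if "g \<in> G" for g using \<theta> that by auto
    show "(\<pi> \<circ> \<theta>) (g \<circ> h) = (\<pi> \<circ> \<theta>) g \<circ> (\<pi> \<circ> \<theta>) h" if "g \<in> G" "h \<in> G" for g h
      using \<theta> that \<pi>mul by simp
    show "(\<pi> \<circ> \<theta>) g x = g x" if "g \<in> G" "x \<in> X" for g x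
    proof -
      have x: "x \<in> X'" "g x \<in> X'"
        using XX'(1) that finite_isometry_groupD(4)[OF G that] by (simp_all add: subsetD)
      have \<iota>x: "\<iota> x \<in> Z" "\<iota> (g x) \<in> Z"
        using \<iota>(1) x by (simp_all add: image_subset_iff)
      have "\<pi> (\<theta> g) x = \<phi> (act (\<theta> g) (\<iota> x))" using \<pi>[of "\<theta> g" "\<iota> x"] \<phi>(2) x \<iota>x \<theta>(1) that by simp
      moreover have "dist (\<phi> (act (\<theta> g) (\<iota> x))) (\<phi> (\<iota> (g x))) = 0"
        using \<phi>(1) \<iota>x \<theta>(1,3) act(1) that by simp
      ultimately show ?thesis using \<phi>(2) x by simp
    qed
  qed
  show ?thesis
    by (rule that[OF H XY E _ \<phi>(1,2) _ \<pi>]) (auto simp: Y_def)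
qed

section \<open>Extending partial involutions approximately\<close>

text \<open>
  Represent a point \<open>x\<close> by the family \<open>(F s x)\<close> indexed by \<open>s \<in> S\<close>, with the supremum distance. All
  permutations of the index set \<open>S\<close> act by isometries on such families, so a finite group that
  contains both \<open>G\<close> and an approximation of the partial map \<open>q\<close> is the full symmetric group of
  \<open>S\<close>, as soon as \<open>G\<close> and \<open>q\<close> are mirrored by permutations \<open>\<sigma> g\<close> and \<open>\<tau>\<close> of the indices. The abstract
  space consists of the pairs \<open>(k, x)\<close>, which stand for the families \<open>(F (k s) x)\<close>. Since
  permutations act on indices, products are reversed.
\<close>

lemma realize_by_permutations:
  fixes F :: "'s \<Rightarrow> 'u::metric_space \<Rightarrow> real"
  assumes U: "urysohn_space TYPE('u)"
    and G: "finite_isometry_group X G" and XX': "X \<subseteq> X'" "finite X'"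
    and S: "finite S"
    and Lip: "\<And>s x y. s \<in> S \<Longrightarrow> x \<in> X' \<Longrightarrow> y \<in> X' \<Longrightarrow> \<bar>F s x - F s y\<bar> \<le> dist x y"
    and sep: "\<And>x y. x \<in> X' \<Longrightarrow> y \<in> X' \<Longrightarrow> \<exists>s\<in>S. \<bar>F s x - F s y\<bar> = dist x y"
    and \<sigma>: "\<And>g. g \<in> G \<Longrightarrow> \<sigma> g permutes S"
      "\<And>g h. g \<in> G \<Longrightarrow> h \<in> G \<Longrightarrow> \<sigma> (g \<circ> h) = \<sigma> h \<circ> \<sigma> g"
      "\<And>g s x. g \<in> G \<Longrightarrow> s \<in> S \<Longrightarrow> x \<in> X \<Longrightarrow> F (\<sigma> g s) x = F s (g x)"
    and \<tau>: "\<tau> permutes S" "\<And>s a. s \<in> S \<Longrightarrow> a \<in> A \<Longrightarrow> \<bar>F (\<tau> s) a - F s (q a)\<bar> \<le> \<delta>"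
    and A: "A \<subseteq> X'" "q ` A \<subseteq> X'" and \<delta>: "0 \<le> \<delta>"
  obtains Y H e h where "finite_isometry_group Y H" "X' \<subseteq> Y" "group_extension X G Y H e"
    "h \<in> H" "\<And>a. a \<in> A \<Longrightarrow> dist (h a) (q a) \<le> \<delta>"
proof -
  define K where "K = {k. k permutes S}"
  define Z where "Z = K \<times> X'"
  define \<rho> where "\<rho> z w = Max (insert 0 ((\<lambda>s. \<bar>F (fst z s) (snd z) - F (fst w s) (snd w)\<bar>) ` S))" for z w
  define act where "act k z = (fst z \<circ> k, snd z)" for k :: "'s \<Rightarrow> 's" and z :: "('s \<Rightarrow> 's) \<times> 'u"
  have \<rho>_le: "\<rho> z w \<le> c \<longleftrightarrow> 0 \<le> c \<and> (\<forall>s\<in>S. \<bar>F (fst z s) (snd z) - F (fst w s) (snd w)\<bar> \<le> c)" for z w c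
    unfolding \<rho>_def using S by (subst Max_le_iff) auto
  have \<rho>_ge: "\<bar>F (fst z s) (snd z) - F (fst w s) (snd w)\<bar> \<le> \<rho> z w" if "s \<in> S" for z w s
    using \<rho>_le[of z w "\<rho> z w"] that by blast
  have \<rho>0: "0 \<le> \<rho> z w" for z w using \<rho>_le[of z w "\<rho> z w"] by blast
  have finK: "finite K" unfolding K_def using S by (rule finite_permutations)
  have finZ: "finite Z" using finK XX' by (simp add: Z_def)
  have pm: "pseudometric_on Z \<rho>"
    unfolding pseudometric_on_def
  proof (intro conjI ballI)
    show "\<rho> x x = 0" for x using \<rho>_le[of x x 0] \<rho>0[of x x] by auto
    show "0 \<le> \<rho> x y" for x y by (rule \<rho>0)
    show "\<rho> x y = \<rho> y x" for x y unfolding \<rho>_def by (simp add: abs_minus_commute)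
    show "\<rho> x z \<le> \<rho> x y + \<rho> y z" for x y z
      unfolding \<rho>_le[of x z]
    proof (intro conjI ballI)
      show "0 \<le> \<rho> x y + \<rho> y z" using \<rho>0[of x y] \<rho>0[of y z] by simp
      fix s assume "s \<in> S"
      with \<rho>_ge[of s x y] \<rho>_ge[of s y z]
      show "\<bar>F (fst x s) (snd x) - F (fst z s) (snd z)\<bar> \<le> \<rho> x y + \<rho> y z" by linarith
    qed
  qed
  have act\<rho>: "\<rho> (act k z) (act k w) = \<rho> z w" if "k \<in> K" for k z w
  proof -
    have "k ` S = S" using that by (simp add: K_def permutes_image)
    hence "(\<lambda>s. \<bar>F (fst z s) (snd z) - F (fst w s) (snd w)\<bar>) ` S =
           (\<lambda>s. \<bar>F (fst z s) (snd z) - F (fst w s) (snd w)\<bar>) ` (k ` S)" by simp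
    thus ?thesis unfolding \<rho>_def act_def by (simp add: image_image)
  qed
  define \<iota> where "\<iota> x = (id :: 's \<Rightarrow> 's, x)" for x :: 'u
  have idK: "id \<in> K" by (simp add: K_def permutes_id)
  have \<iota>\<rho>: "\<rho> (\<iota> x) (\<iota> y) = dist x y" if "x \<in> X'" "y \<in> X'" for x y
  proof (rule antisym)
    show "\<rho> (\<iota> x) (\<iota> y) \<le> dist x y" unfolding \<rho>_le using Lip that by (simp add: \<iota>_def)
    obtain s where "s \<in> S" "\<bar>F s x - F s y\<bar> = dist x y" using sep \<open>x \<in> X'\<close> \<open>y \<in> X'\<close> by blast
    with \<rho>_ge[of s "\<iota> x" "\<iota> y"] show "dist x y \<le> \<rho> (\<iota> x) (\<iota> y)" by (simp add: \<iota>_def)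
  qed
  have \<theta>\<rho>: "\<rho> (act (\<sigma> g) (\<iota> x)) (\<iota> (g x)) = 0" if "g \<in> G" "x \<in> X" for g x
    using \<rho>_le[of "act (\<sigma> g) (\<iota> x)" "\<iota> (g x)" 0] \<rho>0[of "act (\<sigma> g) (\<iota> x)" "\<iota> (g x)"] \<sigma>(3)[OF that(1) _ that(2)]
    by (simp add: \<iota>_def act_def)
  have \<iota>Z: "\<iota> ` X' \<subseteq> Z" using idK by (auto simp: \<iota>_def Z_def)
  have actid: "act id z = z" if "z \<in> Z" for z by (simp add: act_def)
  have mul: "l \<circ> k \<in> K" if "k \<in> K" "l \<in> K" for k l
    using that by (simp add: K_def permutes_compose)
  have actmul: "act (l \<circ> k) z = act k (act l z)" for k l z by (simp add: act_def o_assoc)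
  have actZ: "act k z \<in> Z" if "k \<in> K" "z \<in> Z" for k z
    using that mul by (simp add: act_def Z_def mem_Times_iff)
  have \<sigma>K: "\<sigma> g \<in> K" if "g \<in> G" for g using \<sigma>(1)[OF that] by (simp add: K_def)
  show ?thesis
  proof (rule realize_action[where act=act and mul="\<lambda>k l. l \<circ> k" and \<theta>=\<sigma>,
          OF U finZ pm G XX' \<iota>Z \<iota>\<rho> idK actid mul actmul actZ act\<rho> \<sigma>K \<sigma>(2) \<theta>\<rho>])
    fix Y H e \<phi> \<pi>
    assume R: "finite_isometry_group Y H" "X' \<subseteq> Y" "group_extension X G Y H e"
      "\<phi> ` Z = Y" "\<And>z w. z \<in> Z \<Longrightarrow> w \<in> Z \<Longrightarrow> dist (\<phi> z) (\<phi> w) = \<rho> z w"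
      "\<And>x. x \<in> X' \<Longrightarrow> \<phi> (\<iota> x) = x" "\<pi> ` K = H"
      "\<And>k z. k \<in> K \<Longrightarrow> z \<in> Z \<Longrightarrow> \<pi> k (\<phi> z) = \<phi> (act k z)"
      "\<And>g. g \<in> G \<Longrightarrow> e g = \<pi> (\<sigma> g)"
    have "\<tau> \<in> K" using \<tau> by (simp add: K_def)
    moreover have "dist (\<pi> \<tau> a) (q a) \<le> \<delta>" if "a \<in> A" for a
    proof -
      have a: "a \<in> X'" "q a \<in> X'" using that A by auto
      have m: "\<iota> a \<in> Z" "act \<tau> (\<iota> a) \<in> Z" "\<iota> (q a) \<in> Z"
        using a idK \<open>\<tau> \<in> K\<close> by (auto simp: Z_def \<iota>_def act_def)
      have "\<pi> \<tau> a = \<phi> (act \<tau> (\<iota> a))" using R(8)[OF \<open>\<tau> \<in> K\<close> m(1)] R(6)[OF a(1)] by simp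
      hence "dist (\<pi> \<tau> a) (q a) = \<rho> (act \<tau> (\<iota> a)) (\<iota> (q a))"
        using R(5)[OF m(2,3)] R(6)[OF a(2)] by simp
      also have "\<dots> \<le> \<delta>" unfolding \<rho>_le using \<tau>(2) that \<delta> by (simp add: act_def \<iota>_def)
      finally show ?thesis .
    qed
    moreover have "\<pi> \<tau> \<in> H" using R(7) \<open>\<tau> \<in> K\<close> by blast
    ultimately show ?thesis using that[OF R(1-3), of "\<pi> \<tau>"] by simp
  qed assumption+
qed

text \<open>
  The least nonnegative 1-Lipschitz function that is at least \<open>f\<close> on \<open>C\<close> (McShane's extension,
  cut off at zero). In contrast to the greatest extension it inherits every nonnegative upper bound of
  the values of \<open>f\<close>.
\<close>

definition lower_extension :: "'u::metric_space set \<Rightarrow> ('u \<Rightarrow> real) \<Rightarrow> 'u \<Rightarrow> real" where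
  "lower_extension C f x = Max (insert 0 ((\<lambda>c. f c - dist c x) ` C))"

context
  fixes C :: "'u::metric_space set" assumes C: "finite C"
begin

lemma lower_extension_le_iff:
  "lower_extension C f x \<le> M \<longleftrightarrow> 0 \<le> M \<and> (\<forall>c\<in>C. f c - dist c x \<le> M)"
  unfolding lower_extension_def using C by (subst Max_le_iff) auto

lemma lower_extension_nonneg: "0 \<le> lower_extension C f x"
  using lower_extension_le_iff[of f x "lower_extension C f x"] by blast

lemma lower_extension_ge: "c \<in> C \<Longrightarrow> f c - dist c x \<le> lower_extension C f x"
  using lower_extension_le_iff[of f x "lower_extension C f x"] by blast

lemma lower_extension_lipschitz: "\<bar>lower_extension C f x - lower_extension C f y\<bar> \<le> dist x y"
proof -
  have "lower_extension C f x \<le> lower_extension C f y + dist x y" for x y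
    unfolding lower_extension_le_iff[of f x]
  proof (intro conjI ballI)
    show "0 \<le> lower_extension C f y + dist x y" using lower_extension_nonneg[of f y] by simp
    show "f c - dist c x \<le> lower_extension C f y + dist x y" if "c \<in> C" for c
      using lower_extension_ge[OF that, of f y] dist_triangle[of c y x] by linarith
  qed
  from this[of x y] this[of y x] show ?thesis by (simp add: dist_commute abs_le_iff)
qed

lemma lower_extension_le:
  assumes "0 \<le> M" "\<And>c. c \<in> C \<Longrightarrow> f c \<le> M" shows "lower_extension C f x \<le> M"
  unfolding lower_extension_le_iff
proof (intro conjI ballI)
  show "f c - dist c x \<le> M" if "c \<in> C" for c
    using assms(2)[OF that] zero_le_dist[of c x] by linarith
qed (rule assms)

lemma lower_extension_eq:
  assumes "x \<in> C" "\<And>c. c \<in> C \<Longrightarrow> f c - dist c x \<le> f x"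
  shows "lower_extension C f x = max 0 (f x)"
proof (rule antisym)
  show "lower_extension C f x \<le> max 0 (f x)"
    unfolding lower_extension_le_iff using assms(2) by (simp add: max.coboundedI2)
  show "max 0 (f x) \<le> lower_extension C f x"
    using lower_extension_nonneg[of f x] lower_extension_ge[OF assms(1), of f x] by simp
qed

end

text \<open>
  The functions attached to the indices. A function \<open>f\<close> can be followed by a group element
  \<open>g\<close>, which determines \<open>f \<circ> g\<close> on \<open>X\<close> only, or by the partial involution \<open>q\<close>, which determines \<open>f \<circ> q\<close> on
  \<open>A\<close> only; in both cases the values elsewhere come from the lower extension. Starting from the
  distance to a base point \<open>b\<close>, a word over \<open>G\<close> lists the group elements applied between successive
  applications of \<open>q\<close>. Each application of \<open>q\<close> lowers the function by \<open>\<delta>\<close>, hence the function vanishes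
  for all long words.
\<close>

definition turn :: "'u::metric_space set \<Rightarrow> ('u \<Rightarrow> 'u) \<Rightarrow> ('u \<Rightarrow> real) \<Rightarrow> 'u \<Rightarrow> real" where
  "turn X g f = (if g = id then f else lower_extension X (f \<circ> g))"

primrec unfolded_distance ::
  "'u::metric_space set \<Rightarrow> 'u set \<Rightarrow> ('u \<Rightarrow> 'u) \<Rightarrow> real \<Rightarrow> 'u \<Rightarrow> ('u \<Rightarrow> 'u) list \<Rightarrow> 'u \<Rightarrow> real" where
  "unfolded_distance X A q \<delta> b [] = dist b"
| "unfolded_distance X A q \<delta> b (g # v) =
     lower_extension A (\<lambda>c. turn X g (unfolded_distance X A q \<delta> b v) (q c) - \<delta>)"

text \<open>
  Normal forms in the free product of \<open>G\<close> with a group of order two: two consecutive applications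
  of \<open>q\<close> cancel and therefore must be separated by a nontrivial element. The last entry of the list
  precedes the first application of \<open>q\<close> and is arbitrary.
\<close>

primrec reduced_word :: "('u \<Rightarrow> 'u) set \<Rightarrow> ('u \<Rightarrow> 'u) list \<Rightarrow> bool" where
  "reduced_word G [] \<longleftrightarrow> True"
| "reduced_word G (g # v) \<longleftrightarrow> g \<in> G \<and> (g \<noteq> id \<or> v = []) \<and> reduced_word G v"

lemma reduced_word_set: "reduced_word G v \<Longrightarrow> set v \<subseteq> G"
  by (induction v) auto

text \<open>
  Indices are triples of a base point, a reduced word of length at most \<open>N\<close> and a group element
  waiting to be applied. The group acts on the last component, and \<open>\<tau>\<close> joins the pending
  element to the word or, if nothing is pending, undoes the last application of \<open>q\<close>. Freeness of
  this tree of words means that no compatibility condition arises between functions reached along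
  different paths; the only conflict would be at the truncation depth \<open>N\<close>, where \<open>\<tau>\<close> cannot move
  further, and there all functions are zero.
\<close>

lemma realize_involution:
  fixes q :: "'u::metric_space \<Rightarrow> 'u"
  assumes U: "urysohn_space TYPE('u)"
    and G: "finite_isometry_group X G" and XX': "X \<subseteq> X'" "finite X'"
    and A: "A \<subseteq> X'" and q: "q ` A \<subseteq> A" "isometric_on A q" "\<And>a. a \<in> A \<Longrightarrow> q (q a) = a"
    and \<delta>: "0 < \<delta>"
  obtains Y H e h where "finite_isometry_group Y H" "X' \<subseteq> Y" "group_extension X G Y H e"
    "h \<in> H" "\<And>a. a \<in> A \<Longrightarrow> dist (h a) (q a) \<le> \<delta>"
proof -
  have finX: "finite X" and finA: "finite A" using XX' A finite_subset by auto
  obtain R where R: "\<And>x y. x \<in> X' \<Longrightarrow> y \<in> X' \<Longrightarrow> dist x y \<le> R"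
    using finite_diameter_bound[OF XX'(2)] by blast
  \<comment> \<open>Distance functions are bounded by R on X', so N reductions by \<delta> leave only zero.\<close>
  obtain N :: nat where N: "R / \<delta> \<le> real N" using real_arch_simple by blast
  hence N: "R - \<delta> * real N \<le> 0" using \<delta> by (simp add: field_simps)
  let ?D = "unfolded_distance X A q \<delta>"
  define F where "F s = turn X (snd (snd s)) (?D (fst s) (fst (snd s)))" for s
  have F: "F (b, v, g) = turn X g (?D b v)" for b v g by (simp add: F_def)
  define S where "S = X' \<times> {v. reduced_word G v \<and> length v \<le> N} \<times> G"
  have finG: "finite G" using G by (rule finite_isometry_group_finite)
  have finS: "finite S"
  proof -
    have "finite {v. reduced_word G v \<and> length v \<le> N}"
      by (rule finite_subset[OF _ finite_lists_length_le[OF finG, of N]]) (auto dest: reduced_word_set)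
    thus ?thesis using XX' finG by (simp add: S_def)
  qed
  have lipD: "\<bar>?D b v x - ?D b v y\<bar> \<le> dist x y" for b v x y
  proof (cases v)
    case Nil
    have "\<bar>dist b x - dist b y\<bar> \<le> dist x y"
      using abs_dist_diff_le[of x b y] by (simp add: dist_commute)
    with Nil show ?thesis by simp
  qed (simp add: lower_extension_lipschitz[OF finA])
  have lipF: "\<bar>F s x - F s y\<bar> \<le> dist x y" for s x y
    unfolding F_def turn_def by (simp add: lipD lower_extension_lipschitz[OF finX])
  have D0: "0 \<le> ?D b v x" for b v x by (cases v) (simp_all add: lower_extension_nonneg[OF finA])
  have F0: "0 \<le> F s x" for s x
    unfolding F_def turn_def by (simp add: D0 lower_extension_nonneg[OF finX])
  have turn_X: "F (b, v, g) x = ?D b v (g x)" if "g \<in> G" "x \<in> X" for b v g x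
  proof (cases "g = id")
    case False
    have "lower_extension X (?D b v \<circ> g) x = max 0 ((?D b v \<circ> g) x)"
    proof (rule lower_extension_eq[OF finX \<open>x \<in> X\<close>])
      fix c assume "c \<in> X"
      hence "dist (g c) (g x) = dist c x"
        using finite_isometry_groupD(5)[OF G \<open>g \<in> G\<close>] \<open>x \<in> X\<close> by (simp add: isometric_onD)
      thus "(?D b v \<circ> g) c - dist c x \<le> (?D b v \<circ> g) x" using lipD[of b v "g c" "g x"] by simp
    qed
    thus ?thesis using False D0 by (simp add: F turn_def)
  qed (simp add: F turn_def)
  have bound_turn: "F (b, v, g) x \<le> max 0 (R - \<delta> * real (length v))"
    if "\<And>x. x \<in> X' \<Longrightarrow> ?D b v x \<le> max 0 (R - \<delta> * real (length v))" "g \<in> G" "x \<in> X'" for b v g x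
  proof (cases "g = id")
    case False
    have "lower_extension X (?D b v \<circ> g) x \<le> max 0 (R - \<delta> * real (length v))"
    proof (rule lower_extension_le[OF finX])
      fix c assume "c \<in> X"
      hence "g c \<in> X'" using finite_isometry_groupD(4)[OF G \<open>g \<in> G\<close>] XX' by blast
      thus "(?D b v \<circ> g) c \<le> max 0 (R - \<delta> * real (length v))" using that(1) by simp
    qed simp
    thus ?thesis using False by (simp add: F turn_def)
  qed (use that in \<open>simp add: F turn_def\<close>)
  have bound: "?D b v x \<le> max 0 (R - \<delta> * real (length v))"
    if "b \<in> X'" "reduced_word G v" "x \<in> X'" for b v x
    using that(2,3)
  proof (induction v arbitrary: x)
    case Nil thus ?case using R[OF that(1)] by (simp add: le_max_iff_disj)
  next
    case (Cons g v)
    have *: "F (b, v, g) (q c) \<le> max 0 (R - \<delta> * real (length v))" if "c \<in> A" for c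
      by (rule bound_turn) (use Cons that q A in auto)
    show ?case unfolding unfolded_distance.simps
    proof (rule lower_extension_le[OF finA])
      show "turn X g (?D b v) (q c) - \<delta> \<le> max 0 (R - \<delta> * real (length (g # v)))" if "c \<in> A" for c
        using *[OF that] \<delta> by (auto simp: F algebra_simps max_def split: if_splits)
    qed simp
  qed
  have boundF: "F (b, v, g) x \<le> max 0 (R - \<delta> * real (length v))" if "(b, v, g) \<in> S" "x \<in> X'" for b v g x
    by (rule bound_turn) (use that bound in \<open>auto simp: S_def\<close>)
  \<comment> \<open>On A the lower extension is exact because q is isometric there.\<close>
  have step: "?D b (g # v) a = max 0 (F (b, v, g) (q a) - \<delta>)" if "a \<in> A" for b v g a
    unfolding unfolded_distance.simps F
  proof (rule lower_extension_eq[OF finA that])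
    fix c assume "c \<in> A"
    hence "dist (q c) (q a) = dist c a" using q that by (simp add: isometric_onD)
    thus "turn X g (?D b v) (q c) - \<delta> - dist c a \<le> turn X g (?D b v) (q a) - \<delta>"
      using lipF[of "(b, v, g)" "q c" "q a"] by (simp add: F)
  qed
  define \<sigma> where "\<sigma> g s = (if s \<in> S then (fst s, fst (snd s), snd (snd s) \<circ> g) else s)" for g s
  have comp: "g \<circ> h \<in> G" if "g \<in> G" "h \<in> G" for g h using finite_isometry_groupD(3)[OF G that] .
  have \<sigma>S: "\<sigma> g s \<in> S" if "g \<in> G" "s \<in> S" for g s
    using that comp by (auto simp: \<sigma>_def S_def)
  \<comment> \<open>The group acts on the right of the pending element, hence the reversed product.\<close>
  have \<sigma>mul: "\<sigma> (g \<circ> h) = \<sigma> h \<circ> \<sigma> g" if "g \<in> G" "h \<in> G" for g h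
  proof
    fix s show "\<sigma> (g \<circ> h) s = (\<sigma> h \<circ> \<sigma> g) s"
    proof (cases "s \<in> S")
      case True thus ?thesis using \<sigma>S[OF that(1) True] by (simp add: \<sigma>_def o_assoc)
    qed (simp add: \<sigma>_def)
  qed
  have \<sigma>id: "\<sigma> id = id" by (auto simp: \<sigma>_def)
  have \<sigma>perm: "\<sigma> g permutes S" if "g \<in> G" for g
  proof -
    obtain h where h: "h \<in> G" "g \<circ> h = id" "h \<circ> g = id"
      using finite_isometry_group_inverse[OF G \<open>g \<in> G\<close>] by blast
    have *: "\<sigma> h \<circ> \<sigma> g = id" "\<sigma> g \<circ> \<sigma> h = id"
      using \<sigma>mul[OF that h(1)] \<sigma>mul[OF h(1) that] h \<sigma>id by simp_all
    show ?thesis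
    proof (rule bij_imp_permutes)
      show "bij_betw (\<sigma> g) S S"
        by (rule bij_betw_byWitness[of _ "\<sigma> h"])
           (use * \<sigma>S that h in \<open>auto simp: fun_eq_iff\<close>)
    qed (simp add: \<sigma>_def)
  qed
  have \<sigma>F: "F (\<sigma> g s) x = F s (g x)" if "g \<in> G" "s \<in> S" "x \<in> X" for g s x
  proof -
    obtain b v h where s: "s = (b, v, h)" by (cases s)
    have h: "h \<in> G" using that s by (simp add: S_def)
    have gx: "g x \<in> X" using finite_isometry_groupD(4)[OF G that(1,3)] .
    show ?thesis using turn_X[OF comp[OF h that(1)] that(3)] turn_X[OF h gx] that s
      by (simp add: \<sigma>_def)
  qed
  define \<tau> where "\<tau> s = (case s of (b, v, g) \<Rightarrow>
     if s \<notin> S then s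
     else if g \<noteq> id \<or> v = [] then (if length v < N then (b, g # v, id) else s)
     else (b, tl v, hd v))" for s
  have idG: "id \<in> G" using G by (rule finite_isometry_groupD)
  have \<tau>S: "\<tau> s \<in> S \<and> \<tau> (\<tau> s) = s" if "s \<in> S" for s
  proof -
    obtain b v g where s: "s = (b, v, g)" by (cases s)
    show ?thesis
    proof (cases "g \<noteq> id \<or> v = []")
      case True
      thus ?thesis using that idG by (auto simp: \<tau>_def s S_def)
    next
      case False
      then obtain h w where v: "v = h # w" by (cases v) auto
      thus ?thesis using that idG False by (auto simp: \<tau>_def s S_def)
    qed
  qed
  have \<tau>perm: "\<tau> permutes S"
  proof (rule bij_imp_permutes)
    show "bij_betw \<tau> S S"
      by (rule bij_betw_byWitness[of _ \<tau>]) (use \<tau>S in auto)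
  qed (simp add: \<tau>_def split: prod.splits)
  have near: "\<bar>max 0 (t - \<delta>) - t\<bar> \<le> \<delta>" if "0 \<le> t" for t using that \<delta> by (auto simp: max_def)
  have \<tau>F: "\<bar>F (\<tau> s) a - F s (q a)\<bar> \<le> \<delta>" if sS: "s \<in> S" and a: "a \<in> A" for s a
  proof -
    obtain b v g where s: "s = (b, v, g)" by (cases s)
    have qa: "q a \<in> A" using q a by blast
    consider "g \<noteq> id \<or> v = []" "length v < N" | "g \<noteq> id \<or> v = []" "\<not> length v < N"
      | "g = id" "v \<noteq> []" by blast
    thus ?thesis
    proof cases
      case 1
      hence "\<tau> s = (b, g # v, id)" using sS by (auto simp: \<tau>_def s)
      hence "F (\<tau> s) a = max 0 (F s (q a) - \<delta>)" using step[OF a] by (simp add: F turn_def s)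
      thus ?thesis using near[OF F0] by simp
    next
      case 2
      hence "\<tau> s = s" using sS by (auto simp: \<tau>_def s)
      moreover have "length v = N" using 2 sS by (simp add: S_def s)
      hence "F s x = 0" if "x \<in> A" for x
        using boundF[of b v g x] sS s that A N F0[of s x] by (auto simp: subset_iff)
      ultimately show ?thesis using \<delta> a qa by simp
    next
      case 3
      then obtain h w where v: "v = h # w" by (cases v) auto
      have "\<tau> s = (b, w, h)" using 3 v sS by (auto simp: \<tau>_def s)
      moreover have "F s (q a) = max 0 (F (b, w, h) a - \<delta>)"
        using step[OF qa, of b h w] q(3)[OF a] 3 v by (simp add: F turn_def s)
      ultimately show ?thesis using near[OF F0[of "(b, w, h)" a]] by (simp add: abs_minus_commute)
    qed
  qed
  have sep: "\<exists>s\<in>S. \<bar>F s x - F s y\<bar> = dist x y" if "x \<in> X'" "y \<in> X'" for x y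
    by (rule bexI[of _ "(x, [], id)"]) (use that idG in \<open>auto simp: F turn_def S_def\<close>)
  have "q ` A \<subseteq> X'" using q A by blast
  show ?thesis
  proof (rule realize_by_permutations[OF U G XX' finS lipF sep \<sigma>perm \<sigma>mul \<sigma>F \<tau>perm \<tau>F A
          \<open>q ` A \<subseteq> X'\<close> less_imp_le[OF \<delta>]])
    fix Y H e h
    assume "finite_isometry_group Y H" "X' \<subseteq> Y" "group_extension X G Y H e"
      "h \<in> H" "\<And>a. a \<in> A \<Longrightarrow> dist (h a) (q a) \<le> \<delta>"
    thus ?thesis by (rule that)
  qed assumption+
qed

section \<open>Extending partial isometries approximately\<close>

text \<open>
  Two isometric copies of \<open>A\<close> at constant mutual distance can be exchanged by an involution of
  their union, because every cross distance equals \<open>R\<close> before and after.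
\<close>

lemma realize_swap:
  fixes f g :: "'u::metric_space \<Rightarrow> 'u"
  assumes U: "urysohn_space TYPE('u)"
    and G: "finite_isometry_group X G" and XX': "X \<subseteq> X'" "finite X'"
    and f: "f ` A \<subseteq> X'" "isometric_on A f" and g: "g ` A \<subseteq> X'" "isometric_on A g"
    and R: "0 < R" "\<And>a b. a \<in> A \<Longrightarrow> b \<in> A \<Longrightarrow> dist (f a) (g b) = R"
    and \<delta>: "0 < \<delta>"
  obtains Y H e h where "finite_isometry_group Y H" "X' \<subseteq> Y" "group_extension X G Y H e"
    "h \<in> H" "\<And>a. a \<in> A \<Longrightarrow> dist (h (f a)) (g a) \<le> \<delta>"
proof -
  define q where "q x = (if x \<in> f ` A then g (inv_into A f x) else f (inv_into A g x))" for x
  have inj: "inj_on f A" "inj_on g A" using f g isometric_on_inj by blast+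
  have ne: "f a \<noteq> g b" if "a \<in> A" "b \<in> A" for a b using R(2)[OF that] R(1) by auto
  have qf: "q (f a) = g a" if "a \<in> A" for a using that inj by (simp add: q_def)
  have qg: "q (g a) = f a" if "a \<in> A" for a
  proof -
    have "g a \<notin> f ` A" using ne that by fastforce
    thus ?thesis using that inj by (simp add: q_def)
  qed
  have R': "dist (g b) (f a) = R" if "a \<in> A" "b \<in> A" for a b
    using R(2)[OF that] by (simp add: dist_commute)
  define B where "B = f ` A \<union> g ` A"
  have B: "B \<subseteq> X'" "q ` B \<subseteq> B" using f(1) g(1) qf qg by (auto simp: B_def)
  have iso: "isometric_on B q"
    unfolding isometric_on_def
  proof (intro ballI)
    fix x y assume "x \<in> B" "y \<in> B"
    thus "dist (q x) (q y) = dist x y"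
      using isometric_onD[OF f(2)] isometric_onD[OF g(2)]
      by (auto simp: B_def qf qg R(2) R')
  qed
  have inv: "q (q x) = x" if "x \<in> B" for x using that by (auto simp: B_def qf qg)
  show ?thesis
  proof (rule realize_involution[OF U G XX' B iso inv \<delta>])
    fix Y H e h
    assume *: "finite_isometry_group Y H" "X' \<subseteq> Y" "group_extension X G Y H e"
      "h \<in> H" "\<And>a. a \<in> B \<Longrightarrow> dist (h a) (q a) \<le> \<delta>"
    show ?thesis
    proof (rule that[OF *(1-4)])
      show "dist (h (f a)) (g a) \<le> \<delta>" if "a \<in> A" for a
        using *(5)[of "f a"] qf[OF that] that by (simp add: B_def)
    qed
  qed assumption+
qed

text \<open>
  Auxiliary room for decomposing a partial isometry into involutions.
\<close>

lemma distant_copy: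
  fixes X :: "'u::metric_space set"
  assumes U: "urysohn_space TYPE('u)" and X: "finite X" "A \<subseteq> X"
  obtains c R where "isometric_on A c" "0 < R" "\<And>a x. a \<in> A \<Longrightarrow> x \<in> X \<Longrightarrow> dist x (c a) = R"
proof -
  obtain D where D: "0 \<le> D" "\<And>x y. x \<in> X \<Longrightarrow> y \<in> X \<Longrightarrow> dist x y \<le> D"
    using finite_diameter_bound[OF X(1)] by blast
  \<comment> \<open>The triangle inequality needs twice this distance to be at least the diameter; a positive
    distance keeps the copy disjoint from the original.\<close>
  define R where "R = D + 1"
  have R: "dist x y \<le> R" if "x \<in> X" "y \<in> X" for x y using D(2)[OF that] by (simp add: R_def)
  have R0: "0 < R" using D(1) by (simp add: R_def)
  define Z where "Z = X \<times> {False} \<union> A \<times> {True}"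
  define \<rho> where "\<rho> z w = (if snd z = snd w then dist (fst z) (fst w) else R)" for z w :: "'u \<times> bool"
  have ZX: "fst z \<in> X" if "z \<in> Z" for z using that X(2) by (auto simp: Z_def)
  have finZ: "finite Z" using X finite_subset by (auto simp: Z_def)
  have pm: "pseudometric_on Z \<rho>"
    unfolding pseudometric_on_def
  proof (intro conjI ballI)
    show "\<rho> x x = 0" for x by (simp add: \<rho>_def)
    show "0 \<le> \<rho> x y" for x y using R0 by (simp add: \<rho>_def)
    show "\<rho> x y = \<rho> y x" for x y by (simp add: \<rho>_def dist_commute)
    show "\<rho> x z \<le> \<rho> x y + \<rho> y z" if "x \<in> Z" "y \<in> Z" "z \<in> Z" for x y z
    proof (cases "snd x = snd z \<and> snd x = snd y")
      case True
      hence "snd y = snd z" "snd x = snd z" by metis+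
      thus ?thesis by (simp add: \<rho>_def dist_triangle)
    next
      case False
      have "\<rho> x z \<le> R" using R ZX that by (simp add: \<rho>_def)
      moreover have "R \<le> \<rho> x y \<or> R \<le> \<rho> y z" using False by (cases "snd x"; cases "snd y"; cases "snd z"; simp add: \<rho>_def)
      moreover have "0 \<le> \<rho> x y" "0 \<le> \<rho> y z" using R0 by (simp_all add: \<rho>_def)
      ultimately show ?thesis by linarith
    qed
  qed
  have *: "(\<lambda>x. (x, False)) ` X \<subseteq> Z" by (auto simp: Z_def)
  have "\<exists>\<phi> :: 'u \<times> bool \<Rightarrow> 'u. (\<forall>z\<in>Z. \<forall>z'\<in>Z. dist (\<phi> z) (\<phi> z') = \<rho> z z') \<and> (\<forall>x\<in>X. \<phi> (x, False) = x)"
    by (rule finite_pseudometric_extends[OF U finZ pm X(1) *]) (simp add: \<rho>_def)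
  then obtain \<phi> :: "'u \<times> bool \<Rightarrow> 'u" where \<phi>: "\<forall>z\<in>Z. \<forall>z'\<in>Z. dist (\<phi> z) (\<phi> z') = \<rho> z z'"
    "\<forall>x\<in>X. \<phi> (x, False) = x" by blast
  show ?thesis
  proof (rule that[of "\<lambda>a. \<phi> (a, True)" R])
    show "isometric_on A (\<lambda>a. \<phi> (a, True))"
      using \<phi>(1) by (simp add: isometric_on_def Z_def \<rho>_def)
    show "0 < R" by (rule R0)
    fix a x assume ax: "a \<in> A" "x \<in> X"
    hence "dist (\<phi> (x, False)) (\<phi> (a, True)) = \<rho> (x, False) (a, True)"
      using \<phi>(1) by (simp add: Z_def)
    thus "dist x (\<phi> (a, True)) = R" using \<phi>(2) ax by (simp add: \<rho>_def)
  qed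
qed

text \<open>
  Through a distant copy \<open>c ` A\<close> an arbitrary partial isometry becomes a product of two involutions:
  one exchanges \<open>A\<close> with \<open>c ` A\<close>, the next one exchanges \<open>c ` A\<close> with \<open>p ` A\<close>. Each costs half of the
  permitted error.
\<close>

lemma realize_partial_isometry:
  fixes p :: "'u::metric_space \<Rightarrow> 'u"
  assumes U: "urysohn_space TYPE('u)"
    and G: "finite_isometry_group X G" and XX': "X \<subseteq> X'" "finite X'"
    and A: "A \<subseteq> X'" and p: "p ` A \<subseteq> X'" "isometric_on A p" and \<delta>: "0 < \<delta>"
  obtains Y H e h where "finite_isometry_group Y H" "X' \<subseteq> Y" "group_extension X G Y H e"
    "h \<in> H" "\<And>a. a \<in> A \<Longrightarrow> dist (h a) (p a) \<le> \<delta>"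
proof -
  obtain c R where c: "isometric_on A c" and R: "0 < R" "\<And>a x. a \<in> A \<Longrightarrow> x \<in> X' \<Longrightarrow> dist x (c a) = R"
    using distant_copy[OF U XX'(2) A] by blast
  have finA: "finite A" using XX'(2) A finite_subset by blast
  define X1 where "X1 = X' \<union> c ` A"
  have X1: "X \<subseteq> X1" "finite X1" "id ` A \<subseteq> X1" "c ` A \<subseteq> X1" "p ` A \<subseteq> X1"
    using XX' A p finA by (auto simp: X1_def)
  have idA: "isometric_on A id" by (simp add: isometric_on_def)
  have d1: "dist (id a) (c b) = R" if "a \<in> A" "b \<in> A" for a b using R(2)[OF that(2)] that A by auto
  have d2: "dist (c a) (p b) = R" if "a \<in> A" "b \<in> A" for a b
    using R(2)[OF that(1), of "p b"] that p(1) by (auto simp: dist_commute)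
  have \<delta>2: "0 < \<delta> / 2" using \<delta> by simp
  show ?thesis
  proof (rule realize_swap[OF U G X1(1,2,3) idA X1(4) c R(1) d1 \<delta>2])
    fix Y1 H1 e1 h1
    assume 1: "finite_isometry_group Y1 H1" "X1 \<subseteq> Y1" "group_extension X G Y1 H1 e1"
      "h1 \<in> H1" "\<And>a. a \<in> A \<Longrightarrow> dist (h1 (id a)) (c a) \<le> \<delta> / 2"
    have Y1: "finite Y1" "c ` A \<subseteq> Y1" "p ` A \<subseteq> Y1" "A \<subseteq> Y1"
      using finite_isometry_groupD(1)[OF 1(1)] X1 1(2) by auto
    show ?thesis
    proof (rule realize_swap[OF U 1(1) order_refl Y1(1,2) c Y1(3) p(2) R(1) d2 \<delta>2])
      fix Y2 H2 e2 h2
      assume 2: "finite_isometry_group Y2 H2" "Y1 \<subseteq> Y2" "group_extension Y1 H1 Y2 H2 e2"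
        "h2 \<in> H2" "\<And>a. a \<in> A \<Longrightarrow> dist (h2 (c a)) (p a) \<le> \<delta> / 2"
      have "X' \<subseteq> Y2" using 1(2) 2(2) by (auto simp: X1_def)
      moreover have "group_extension X G Y2 H2 (e2 \<circ> e1)"
        by (rule group_extension_trans[OF 1(3) 2(3) G])
      moreover have e2: "e2 h1 \<in> H2" "\<And>x. x \<in> Y1 \<Longrightarrow> e2 h1 x = h1 x"
        using 2(3) 1(4) by (simp_all add: group_extension_def)
      hence "h2 \<circ> e2 h1 \<in> H2" using finite_isometry_groupD(3)[OF 2(1,4)] by blast
      moreover have "dist ((h2 \<circ> e2 h1) a) (p a) \<le> \<delta>" if "a \<in> A" for a
      proof -
        have m: "a \<in> Y1" "h1 a \<in> Y1" "c a \<in> Y1"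
          using Y1 that finite_isometry_groupD(4)[OF 1(1,4)] by auto
        have "dist (h2 (h1 a)) (h2 (c a)) = dist (h1 a) (c a)"
          using isometric_onD[OF finite_isometry_groupD(5)[OF 2(1,4)]] m 2(2) by blast
        hence "dist (h2 (h1 a)) (p a) \<le> \<delta> / 2 + \<delta> / 2"
          using 1(5)[OF that] 2(5)[OF that] dist_triangle[of "h2 (h1 a)" "p a" "h2 (c a)"] by simp
        thus ?thesis using e2(2)[OF m(1)] by simp
      qed
      ultimately show ?thesis using that[OF 2(1)] by blast
    qed assumption+
  qed assumption+
qed

section \<open>Concentration in powers\<close>

definition words :: "'a set \<Rightarrow> nat \<Rightarrow> 'a list set" where
  "words H n = {xs. set xs \<subseteq> H \<and> length xs = n}"

definition hamming :: "'a list \<Rightarrow> 'a list \<Rightarrow> real" where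
  "hamming xs ys = (\<Sum>i<length xs. if xs ! i = ys ! i then 0 else 1)"

lemma words_length: "xs \<in> words H n \<Longrightarrow> length xs = n"
  by (simp add: words_def)

lemma words_nth: "xs \<in> words H n \<Longrightarrow> i < n \<Longrightarrow> xs ! i \<in> H"
  by (auto simp: words_def)

lemma words_0: "words H 0 = {[]}"
  by (auto simp: words_def)

lemma words_Suc: "words H (Suc n) = (\<lambda>(x, xs). x # xs) ` (H \<times> words H n)"
  by (auto simp: words_def length_Suc_conv image_iff)

lemma finite_words: "finite H \<Longrightarrow> finite (words H n)"
  by (simp add: words_def finite_lists_length_eq)

lemma card_words: "finite H \<Longrightarrow> card (words H n) = card H ^ n"
  by (simp add: words_def card_lists_length_eq)

lemma sum_words_Suc: "sum f (words H (Suc n)) = (\<Sum>x\<in>H. \<Sum>xs\<in>words H n. f (x # xs))"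
proof -
  have "inj_on (\<lambda>(x, xs). x # xs) (H \<times> words H n)" by (auto simp: inj_on_def)
  thus ?thesis
    by (simp add: words_Suc sum.reindex sum.cartesian_product case_prod_unfold)
qed

lemma hamming_Cons: "hamming (x # xs) (y # ys) = (if x = y then 0 else 1) + hamming xs ys"
  unfolding hamming_def by (simp add: sum.lessThan_Suc_shift del: sum.lessThan_Suc)

lemma hamming_refl: "hamming xs xs = 0"
  by (simp add: hamming_def)

lemma hamming_nonneg: "0 \<le> hamming xs ys"
  unfolding hamming_def by (rule sum_nonneg) simp

lemma hamming_commute: "length xs = length ys \<Longrightarrow> hamming xs ys = hamming ys xs"
  unfolding hamming_def by (simp add: eq_commute)

lemma hamming_triangle:
  "length xs = length ys \<Longrightarrow> hamming xs zs \<le> hamming xs ys + hamming ys zs"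
  unfolding hamming_def by (auto simp flip: sum.distrib intro!: sum_mono)

lemma sum_square_diff:
  fixes u v :: "'a \<Rightarrow> real"
  shows "(\<Sum>a\<in>S. \<Sum>b\<in>S. (u a - v b)\<^sup>2) =
    card S * (\<Sum>a\<in>S. (u a)\<^sup>2) + card S * (\<Sum>b\<in>S. (v b)\<^sup>2) - 2 * sum u S * sum v S"
proof -
  have "(\<Sum>a\<in>S. \<Sum>b\<in>S. (u a - v b)\<^sup>2) =
        (\<Sum>a\<in>S. \<Sum>b\<in>S. (u a)\<^sup>2) + (\<Sum>a\<in>S. \<Sum>b\<in>S. (v b)\<^sup>2) - (\<Sum>a\<in>S. \<Sum>b\<in>S. 2 * (u a * v b))"
    by (simp add: power2_diff sum.distrib sum_subtractf mult.assoc)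
  also have "(\<Sum>a\<in>S. \<Sum>b\<in>S. 2 * (u a * v b)) = 2 * sum u S * sum v S"
    unfolding mult.assoc sum_product by (simp only: sum_distrib_left)
  finally show ?thesis by (simp add: sum_distrib_left)
qed

text \<open>
  The variance of a 1-Lipschitz function on a Hamming cube grows at most linearly in the dimension,
  independently of the alphabet (an Efron--Stein bound). Splitting off the first letter, the variance
  is the average of the variances of the slices plus the variance of their means, and these means
  differ by at most 1 since a change of the first letter costs at most 1.
\<close>

lemma lipschitz_variance_words:
  fixes f :: "'a list \<Rightarrow> real"
  assumes "finite H"
    and "\<And>xs ys. xs \<in> words H n \<Longrightarrow> ys \<in> words H n \<Longrightarrow> \<bar>f xs - f ys\<bar> \<le> hamming xs ys"
  shows "(\<Sum>xs\<in>words H n. \<Sum>ys\<in>words H n. (f xs - f ys)\<^sup>2) \<le> n * (real (card H ^ n))\<^sup>2"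
  using assms(2)
proof (induction n arbitrary: f)
  case 0 show ?case by (simp add: words_0)
next
  case (Suc n)
  let ?W = "words H n"
  define N where "N = real (card H ^ n)"
  have cardW: "real (card ?W) = N" by (simp add: N_def card_words[OF \<open>finite H\<close>])
  define M where "M x = (\<Sum>xs\<in>?W. f (x # xs))" for x
  define Q where "Q x = (\<Sum>xs\<in>?W. (f (x # xs))\<^sup>2)" for x
  have W: "x # xs \<in> words H (Suc n)" if "x \<in> H" "xs \<in> ?W" for x xs
    using that by (auto simp: words_def)
  have IH: "2 * N * Q x - 2 * (M x)\<^sup>2 \<le> n * N\<^sup>2" if "x \<in> H" for x
  proof -
    have "(\<Sum>xs\<in>?W. \<Sum>ys\<in>?W. (f (x # xs) - f (x # ys))\<^sup>2) \<le> n * (real (card H ^ n))\<^sup>2"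
    proof (rule Suc.IH)
      fix xs ys assume "xs \<in> ?W" "ys \<in> ?W"
      thus "\<bar>f (x # xs) - f (x # ys)\<bar> \<le> hamming xs ys"
        using Suc.prems[OF W W, OF that _ that] by (simp add: hamming_Cons)
    qed
    thus ?thesis unfolding sum_square_diff cardW by (simp add: M_def Q_def N_def power2_eq_square)
  qed
  have M: "\<bar>M x - M y\<bar> \<le> N" if "x \<in> H" "y \<in> H" for x y
  proof -
    have "\<bar>M x - M y\<bar> \<le> (\<Sum>xs\<in>?W. \<bar>f (x # xs) - f (y # xs)\<bar>)"
      unfolding M_def sum_subtractf[symmetric] by (rule sum_abs)
    also have "\<dots> \<le> (\<Sum>xs\<in>?W. 1)"
    proof (rule sum_mono)
      fix xs assume "xs \<in> ?W"
      with Suc.prems[OF W W, OF that(1) _ that(2), of xs xs]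
      show "\<bar>f (x # xs) - f (y # xs)\<bar> \<le> 1" by (simp add: hamming_Cons hamming_refl split: if_splits)
    qed
    finally show ?thesis using cardW by simp
  qed
  have pair: "(\<Sum>xs\<in>?W. \<Sum>ys\<in>?W. (f (x # xs) - f (y # ys))\<^sup>2) \<le> (real n + 1) * N\<^sup>2"
    if "x \<in> H" "y \<in> H" for x y
  proof -
    have "(M x - M y)\<^sup>2 \<le> N\<^sup>2" using M[OF that] by (metis abs_ge_zero power2_abs power_mono)
    moreover have "(\<Sum>xs\<in>?W. \<Sum>ys\<in>?W. (f (x # xs) - f (y # ys))\<^sup>2) = N * Q x + N * Q y - 2 * M x * M y"
      unfolding sum_square_diff cardW by (simp add: M_def Q_def)
    moreover have "(M x - M y)\<^sup>2 = (M x)\<^sup>2 + (M y)\<^sup>2 - 2 * M x * M y" by (simp add: power2_diff)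
    ultimately show ?thesis using IH[OF that(1)] IH[OF that(2)] by (simp add: algebra_simps)
  qed
  have "(\<Sum>xs\<in>words H (Suc n). \<Sum>ys\<in>words H (Suc n). (f xs - f ys)\<^sup>2) =
        (\<Sum>x\<in>H. \<Sum>xs\<in>?W. \<Sum>y\<in>H. \<Sum>ys\<in>?W. (f (x # xs) - f (y # ys))\<^sup>2)"
    by (simp add: sum_words_Suc)
  also have "\<dots> = (\<Sum>x\<in>H. \<Sum>y\<in>H. \<Sum>xs\<in>?W. \<Sum>ys\<in>?W. (f (x # xs) - f (y # ys))\<^sup>2)"
    by (intro sum.cong refl sum.swap)
  also have "\<dots> \<le> (\<Sum>x\<in>H. \<Sum>y\<in>H. (real n + 1) * N\<^sup>2)"
    by (intro sum_mono pair)
  also have "\<dots> = Suc n * (real (card H ^ Suc n))\<^sup>2"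
    by (simp add: N_def power2_eq_square algebra_simps)
  finally show ?case .
qed

text \<open>
  Chebyshev's argument for the Hamming distance \<open>f\<close> to \<open>A\<close>. It vanishes on \<open>A\<close> and is at least
  \<open>\<epsilon> n\<close> on the set \<open>Bad\<close>, so the variance bound limits the product of the proportions of \<open>A\<close> and \<open>Bad\<close>
  by \<open>1 / (\<epsilon>\<^sup>2 n)\<close>. As \<open>A\<close> has proportion at least \<open>\<epsilon>\<close>, the proportion of \<open>Bad\<close> is at most
  \<open>1 / (\<epsilon>\<^sup>3 n)\<close>, which the choice of \<open>n\<close> makes at most \<open>\<epsilon>\<close>.
\<close>

lemma concentration_words:
  assumes H: "finite H" and A: "A \<subseteq> words H n"
    and \<epsilon>: "0 < \<epsilon>" and n: "1 / \<epsilon> ^ 4 \<le> real n"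
    and big: "\<epsilon> * real (card (words H n)) \<le> real (card A)"
  shows "(1 - \<epsilon>) * real (card (words H n)) \<le> real (card {g \<in> words H n. \<exists>a\<in>A. hamming g a < \<epsilon> * n})"
proof (cases "A = {}")
  case True
  hence "real (card (words H n)) = 0" using big \<epsilon> by (simp add: mult_le_0_iff)
  thus ?thesis by simp
next
  case False
  let ?W = "words H n"
  have finW: "finite ?W" using H by (rule finite_words)
  have finA: "finite A" using A finW finite_subset by blast
  define f where "f g = Min (hamming g ` A)" for g
  have f_le: "f g \<le> hamming g a" if "a \<in> A" for g a
    unfolding f_def using finA that by simp
  have f_ex: "\<exists>a\<in>A. f g = hamming g a" for g
    using Min_in[of "hamming g ` A"] finA False unfolding f_def by blast
  have lip: "\<bar>f g - f h\<bar> \<le> hamming g h" if "g \<in> ?W" "h \<in> ?W" for g h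
  proof -
    have "f g \<le> f h + hamming g h" if "g \<in> ?W" "h \<in> ?W" for g h
    proof -
      obtain a where a: "a \<in> A" "f h = hamming h a" using f_ex by blast
      have "length g = length h" using that by (simp add: words_length)
      with f_le[OF a(1), of g] hamming_triangle[of g h a] a(2) show ?thesis by simp
    qed
    from this[OF that] this[OF that(2,1)] show ?thesis
      using hamming_commute[of g h] that by (simp add: words_length)
  qed
  have fA: "f a = 0" if "a \<in> A" for a
  proof -
    obtain b where "f a = hamming a b" using f_ex by blast
    hence "0 \<le> f a" by (simp add: hamming_nonneg)
    thus ?thesis using f_le[OF that, of a] by (simp add: hamming_refl)
  qed
  define Good where "Good = {g \<in> ?W. \<exists>a\<in>A. hamming g a < \<epsilon> * n}"
  define Bad where "Bad = ?W - Good"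
  have fBad: "\<epsilon> * n \<le> f g" if "g \<in> Bad" for g
  proof -
    obtain a where "a \<in> A" "f g = hamming g a" using f_ex by blast
    thus ?thesis using that by (force simp: Bad_def Good_def)
  qed
  have n0: "0 < real n" using n \<epsilon> by (smt (verit) zero_less_divide_1_iff zero_less_power)
  define N where "N = real (card ?W)"
  have N0: "0 < N" using False A finW by (auto simp: N_def card_gt_0_iff)
  have "real (card A) * (real (card Bad) * (\<epsilon> * n)\<^sup>2) = (\<Sum>a\<in>A. \<Sum>b\<in>Bad. (\<epsilon> * n)\<^sup>2)" by simp
  also have "\<dots> \<le> (\<Sum>a\<in>A. \<Sum>b\<in>Bad. (f a - f b)\<^sup>2)"
  proof (intro sum_mono)
    fix a b assume "a \<in> A" "b \<in> Bad"
    thus "(\<epsilon> * n)\<^sup>2 \<le> (f a - f b)\<^sup>2" using fA fBad \<epsilon> n0 by (simp add: power_mono)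
  qed
  also have "\<dots> \<le> (\<Sum>a\<in>A. \<Sum>b\<in>?W. (f a - f b)\<^sup>2)"
    by (intro sum_mono sum_mono2) (auto simp: finW Bad_def)
  also have "\<dots> \<le> (\<Sum>a\<in>?W. \<Sum>b\<in>?W. (f a - f b)\<^sup>2)"
    by (rule sum_mono2) (use A finW in \<open>auto intro: sum_nonneg\<close>)
  also have "\<dots> \<le> n * N\<^sup>2"
    using lipschitz_variance_words[OF H lip] by (simp add: N_def card_words[OF H])
  finally have "real (card A) * real (card Bad) * (\<epsilon>\<^sup>2 * n) * n \<le> N\<^sup>2 * n"
    by (simp add: power2_eq_square mult_ac)
  hence "real (card A) * real (card Bad) * (\<epsilon>\<^sup>2 * n) \<le> N\<^sup>2" using n0 by (simp add: mult_le_cancel_right)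
  moreover have "\<epsilon> * N * real (card Bad) * (\<epsilon>\<^sup>2 * n) \<le> real (card A) * real (card Bad) * (\<epsilon>\<^sup>2 * n)"
    using big \<epsilon> by (intro mult_right_mono) (auto simp: N_def)
  ultimately have "N * (real (card Bad) * (\<epsilon> ^ 3 * n)) \<le> N * N"
    by (simp add: power2_eq_square power3_eq_cube mult_ac)
  hence bad: "real (card Bad) * (\<epsilon> ^ 3 * n) \<le> N" using N0 by simp
  have "1 \<le> \<epsilon> ^ 4 * n" using n \<epsilon> by (simp add: field_simps)
  hence "real (card Bad) * 1 \<le> real (card Bad) * (\<epsilon> ^ 4 * n)" by (intro mult_left_mono) auto
  also have "\<dots> = \<epsilon> * (real (card Bad) * (\<epsilon> ^ 3 * n))" by (simp add: power_numeral_reduce mult_ac)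
  also have "\<dots> \<le> \<epsilon> * N" using bad \<epsilon> by simp
  finally have "real (card Bad) \<le> \<epsilon> * N" by simp
  moreover have "card Bad = card ?W - card Good" "card Good \<le> card ?W"
    unfolding Bad_def using finW by (auto simp: Good_def card_Diff_subset intro: card_mono)
  ultimately show ?thesis by (simp add: Good_def[symmetric] N_def[symmetric] algebra_simps of_nat_diff)
qed

text \<open>
  Replace \<open>X\<close> by its power with the averaged distance and \<open>G\<close> by the corresponding direct power. The
  diagonal is an isometric copy of \<open>X\<close> on which the diagonal subgroup acts as \<open>G\<close> did. For a diagonal
  point \<open>x\<close>, the distance of \<open>h x\<close> and \<open>b x\<close> is at most the diameter of \<open>X\<close> times the normalized Hamming
  distance of \<open>h\<close> and \<open>b\<close>; thus the concentration of Hamming cubes becomes concentration of the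
  displacement of points of \<open>X\<close>, with an exponent chosen after \<open>G\<close>. The action is faithful because it
  is so on every coordinate, which also makes the new group strictly larger.
\<close>

lemma realize_power:
  fixes X :: "'u::metric_space set"
  assumes U: "urysohn_space TYPE('u)" and G: "finite_isometry_group X G"
    and nontrivial: "1 < card G" and \<epsilon>: "0 < \<epsilon>"
  obtains Y H e where "finite_isometry_group Y H" "group_extension X G Y H e" "card G < card H"
    "\<And>B. B \<subseteq> H \<Longrightarrow> \<epsilon> * real (card H) \<le> real (card B) \<Longrightarrow>
       (1 - \<epsilon>) * real (card H) \<le> real (card {h \<in> H. \<exists>b\<in>B. \<forall>x\<in>X. dist (h x) (b x) \<le> \<epsilon>})"
proof -
  have finX: "finite X" using G by (rule finite_isometry_groupD)
  have finG: "finite G" using G by (rule finite_isometry_group_finite)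
  obtain D where D: "0 \<le> D" "\<And>x y. x \<in> X \<Longrightarrow> y \<in> X \<Longrightarrow> dist x y \<le> D"
    using finite_diameter_bound[OF finX] by blast
  \<comment> \<open>The Hamming scale \<eta> must serve both as a proportion below \<epsilon> and, times the diameter, as a
    distance below \<epsilon>.\<close>
  define \<eta> where "\<eta> = \<epsilon> / (D + 1)"
  have \<eta>: "0 < \<eta>" "\<eta> \<le> \<epsilon>" "D * \<eta> \<le> \<epsilon>"
  proof -
    show "0 < \<eta>" using D \<epsilon> by (simp add: \<eta>_def)
    have "\<eta> * (D + 1) = \<epsilon>" using D(1) by (simp add: \<eta>_def)
    hence e: "\<epsilon> = D * \<eta> + \<eta>" by (simp add: algebra_simps)
    thus "\<eta> \<le> \<epsilon>" "D * \<eta> \<le> \<epsilon>" using D \<open>0 < \<eta>\<close> by (simp_all add: zero_le_mult_iff)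
  qed
  obtain m :: nat where "1 / \<eta> ^ 4 \<le> real m" using real_arch_simple by blast
  then obtain n :: nat where n: "1 / \<eta> ^ 4 \<le> real n" "2 \<le> n" by (intro that[of "m + 2"]) auto
  define Z where "Z = words X n"
  define K where "K = words G n"
  define \<rho> where "\<rho> z w = (\<Sum>i<n. dist (z ! i) (w ! i)) / n" for z w :: "'u list"
  define act where "act k z = map2 (\<lambda>g x. g x) k z" for k :: "('u \<Rightarrow> 'u) list" and z :: "'u list"
  define mul where "mul = map2 ((\<circ>) :: ('u \<Rightarrow> 'u) \<Rightarrow> ('u \<Rightarrow> 'u) \<Rightarrow> ('u \<Rightarrow> 'u))"
  have len: "length z = n" if "z \<in> Z" for z using that by (simp add: Z_def words_length)
  have lenK: "length k = n" if "k \<in> K" for k using that by (simp add: K_def words_length)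
  have mem: "z ! i \<in> X" if "z \<in> Z" "i < n" for z i using that words_nth by (auto simp: Z_def)
  have memK: "k ! i \<in> G" if "k \<in> K" "i < n" for k i using that words_nth by (auto simp: K_def)
  have inZ: "z \<in> Z" if "length z = n" "\<And>i. i < n \<Longrightarrow> z ! i \<in> X" for z
    using that by (auto simp: Z_def words_def in_set_conv_nth)
  have inK: "k \<in> K" if "length k = n" "\<And>i. i < n \<Longrightarrow> k ! i \<in> G" for k
    using that by (auto simp: K_def words_def in_set_conv_nth)
  have act_len: "length (act k z) = n" if "k \<in> K" "z \<in> Z" for k z
    using len[OF that(2)] lenK[OF that(1)] by (simp add: act_def)
  have act_nth: "act k z ! i = (k ! i) (z ! i)" if "k \<in> K" "z \<in> Z" "i < n" for k z i
    using len[OF that(2)] lenK[OF that(1)] that(3) by (simp add: act_def)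
  have mul_len: "length (mul k l) = n" if "k \<in> K" "l \<in> K" for k l
    using lenK[OF that(1)] lenK[OF that(2)] by (simp add: mul_def)
  have mul_nth: "mul k l ! i = k ! i \<circ> l ! i" if "k \<in> K" "l \<in> K" "i < n" for k l i
    using lenK[OF that(1)] lenK[OF that(2)] that(3) by (simp add: mul_def)
  have finZ: "finite Z" using finX by (simp add: Z_def finite_words)
  have pm: "pseudometric_on Z \<rho>"
    unfolding pseudometric_on_def
  proof (intro conjI ballI)
    show "\<rho> x x = 0" for x by (simp add: \<rho>_def)
    show "0 \<le> \<rho> x y" for x y by (simp add: \<rho>_def sum_nonneg)
    show "\<rho> x y = \<rho> y x" for x y by (simp add: \<rho>_def dist_commute)
    show "\<rho> x z \<le> \<rho> x y + \<rho> y z" for x y z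
      unfolding \<rho>_def add_divide_distrib[symmetric] sum.distrib[symmetric]
      by (intro divide_right_mono sum_mono dist_triangle) simp
  qed
  have \<iota>Z: "replicate n ` X \<subseteq> Z" by (auto intro!: inZ)
  have \<iota>\<rho>: "\<rho> (replicate n x) (replicate n y) = dist x y" for x y
    using n(2) by (simp add: \<rho>_def)
  have idG: "id \<in> G" using G by (rule finite_isometry_groupD)
  have oneK: "replicate n id \<in> K" by (rule inK) (simp_all add: idG)
  have act_one: "act (replicate n id) z = z" if "z \<in> Z" for z
    by (rule nth_equalityI) (use that in \<open>simp_all add: act_len[OF oneK] len act_nth[OF oneK]\<close>)
  have actZ: "act k z \<in> Z" if "k \<in> K" "z \<in> Z" for k z
  proof (rule inZ)
    show "act k z ! i \<in> X" if i: "i < n" for i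
      unfolding act_nth[OF \<open>k \<in> K\<close> \<open>z \<in> Z\<close> i]
      using finite_isometry_groupD(4)[OF G memK[OF \<open>k \<in> K\<close> i] mem[OF \<open>z \<in> Z\<close> i]] .
  qed (rule act_len[OF that])
  have mulK: "mul k l \<in> K" if "k \<in> K" "l \<in> K" for k l
  proof (rule inK)
    show "mul k l ! i \<in> G" if i: "i < n" for i
      unfolding mul_nth[OF \<open>k \<in> K\<close> \<open>l \<in> K\<close> i]
      using finite_isometry_groupD(3)[OF G memK[OF \<open>k \<in> K\<close> i] memK[OF \<open>l \<in> K\<close> i]] .
  qed (rule mul_len[OF that])
  have act_mul: "act (mul k l) z = act k (act l z)" if "k \<in> K" "l \<in> K" "z \<in> Z" for k l z
    by (rule nth_equalityI)
       (use that in \<open>simp_all add: act_len act_nth actZ mulK mul_nth\<close>)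
  have act_iso: "\<rho> (act k z) (act k w) = \<rho> z w" if "k \<in> K" "z \<in> Z" "w \<in> Z" for k z w
  proof -
    have "dist (act k z ! i) (act k w ! i) = dist (z ! i) (w ! i)" if i: "i < n" for i
      using isometric_onD[OF finite_isometry_groupD(5)[OF G memK[OF \<open>k \<in> K\<close> i]]
          mem[OF \<open>z \<in> Z\<close> i] mem[OF \<open>w \<in> Z\<close> i]] that by (simp add: act_nth \<open>k \<in> K\<close> \<open>z \<in> Z\<close> \<open>w \<in> Z\<close>)
    thus ?thesis by (simp add: \<rho>_def)
  qed
  have \<theta>K: "replicate n g \<in> K" if "g \<in> G" for g by (rule inK) (simp_all add: that)
  have \<theta>mul: "replicate n (g \<circ> h) = mul (replicate n g) (replicate n h)" if "g \<in> G" "h \<in> G" for g h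
    by (rule nth_equalityI) (use that in \<open>simp_all add: mul_len mul_nth \<theta>K\<close>)
  have \<iota>Z': "replicate n x \<in> Z" if "x \<in> X" for x using \<iota>Z that by blast
  have \<theta>\<rho>: "\<rho> (act (replicate n g) (replicate n x)) (replicate n (g x)) = 0" if "g \<in> G" "x \<in> X" for g x
    unfolding \<rho>_def by (simp add: act_nth \<theta>K \<iota>Z' that)
  show ?thesis
  proof (rule realize_action[where act=act and mul=mul and \<theta>="replicate n",
        OF U finZ pm G order_refl finX \<iota>Z \<iota>\<rho> oneK act_one mulK act_mul actZ act_iso \<theta>K \<theta>mul \<theta>\<rho>])
    fix Y H e \<phi> \<pi>
    assume R: "finite_isometry_group Y H" "X \<subseteq> Y" "group_extension X G Y H e"
      "\<phi> ` Z = Y" "\<And>z w. z \<in> Z \<Longrightarrow> w \<in> Z \<Longrightarrow> dist (\<phi> z) (\<phi> w) = \<rho> z w"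
      "\<And>x. x \<in> X \<Longrightarrow> \<phi> (replicate n x) = x" "\<pi> ` K = H"
      "\<And>k z. k \<in> K \<Longrightarrow> z \<in> Z \<Longrightarrow> \<pi> k (\<phi> z) = \<phi> (act k z)"
      "\<And>g. g \<in> G \<Longrightarrow> e g = \<pi> (replicate n g)"
    have dist\<pi>: "dist (\<pi> k x) (\<pi> l x) = (\<Sum>i<n. dist ((k ! i) x) ((l ! i) x)) / n"
      if "k \<in> K" "l \<in> K" "x \<in> X" for k l x
    proof -
      have "\<pi> k x = \<phi> (act k (replicate n x))" "\<pi> l x = \<phi> (act l (replicate n x))"
        using R(8)[OF that(1) \<iota>Z'[OF that(3)]] R(8)[OF that(2) \<iota>Z'[OF that(3)]] R(6)[OF that(3)] by simp_all
      thus ?thesis using R(5)[OF actZ actZ] that \<iota>Z' by (simp add: \<rho>_def act_nth)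
    qed
    have inj: "inj_on \<pi> K"
    proof (rule inj_onI, rule nth_equalityI)
      fix k l assume kl: "k \<in> K" "l \<in> K" "\<pi> k = \<pi> l"
      show "length k = length l" using kl lenK by simp
      fix i assume "i < length k"
      hence i: "i < n" using lenK[OF kl(1)] by simp
      show "k ! i = l ! i"
      proof
        fix x show "(k ! i) x = (l ! i) x"
        proof (cases "x \<in> X")
          case True
          have "(\<Sum>i<n. dist ((k ! i) x) ((l ! i) x)) = 0"
            using dist\<pi>[OF kl(1,2) True] kl(3) n(2) by simp
          hence "\<forall>i\<in>{..<n}. dist ((k ! i) x) ((l ! i) x) = 0" by (subst (asm) sum_nonneg_eq_0_iff) auto
          thus ?thesis using i by simp
        next
          case False
          thus ?thesis using finite_isometry_groupD(6)[OF G memK[OF kl(1) i]]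
              finite_isometry_groupD(6)[OF G memK[OF kl(2) i]] by simp
        qed
      qed
    qed
    have finK: "finite K" using finG by (simp add: K_def finite_words)
    have cardH: "card H = card K" using inj R(7) by (metis card_image)
    have "card K = card G ^ n" using finG by (simp add: K_def card_words)
    moreover have "card G ^ 1 < card G ^ n" using nontrivial n(2) by (intro power_strict_increasing) auto
    ultimately have less: "card G < card H" using cardH by simp
    show thesis
    proof (rule that[OF R(1,3) less])
      fix B assume B: "B \<subseteq> H" "\<epsilon> * real (card H) \<le> real (card B)"
      define A where "A = {k \<in> K. \<pi> k \<in> B}"
      have "\<pi> ` A = B" using B(1) R(7) by (auto simp: A_def)
      moreover have "inj_on \<pi> A" using inj by (rule inj_on_subset) (auto simp: A_def)
      ultimately have cardA: "card A = card B" by (metis card_image)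
      have "\<eta> * real (card K) \<le> \<epsilon> * real (card K)" using \<eta>(2) by (simp add: mult_right_mono)
      hence "\<eta> * real (card (words G n)) \<le> real (card A)"
        using B(2) cardA cardH by (simp add: K_def)
      from concentration_words[OF finG _ \<eta>(1) n(1) this]
      have C: "(1 - \<eta>) * real (card K) \<le> real (card {k \<in> K. \<exists>a\<in>A. hamming k a < \<eta> * n})"
        by (auto simp: K_def A_def)
      define E where "E = {k \<in> K. \<exists>a\<in>A. hamming k a < \<eta> * n}"
      define E' where "E' = {h \<in> H. \<exists>b\<in>B. \<forall>x\<in>X. dist (h x) (b x) \<le> \<epsilon>}"
      have "\<pi> ` E \<subseteq> E'"
      proof (rule image_subsetI)
        fix k assume "k \<in> E"
        then obtain a where k: "k \<in> K" "a \<in> A" "hamming k a < \<eta> * n" by (auto simp: E_def)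
        have a: "a \<in> K" "\<pi> a \<in> B" using k(2) by (auto simp: A_def)
        have "dist (\<pi> k x) (\<pi> a x) \<le> \<epsilon>" if x: "x \<in> X" for x
        proof -
          have "(\<Sum>i<n. dist ((k ! i) x) ((a ! i) x)) \<le> (\<Sum>i<n. D * (if k ! i = a ! i then 0 else 1))"
          proof (rule sum_mono)
            fix i assume "i \<in> {..<n}"
            hence i: "i < n" by simp
            have "(k ! i) x \<in> X" "(a ! i) x \<in> X"
              using finite_isometry_groupD(4)[OF G memK[OF k(1) i] x]
                finite_isometry_groupD(4)[OF G memK[OF a(1) i] x] by auto
            thus "dist ((k ! i) x) ((a ! i) x) \<le> D * (if k ! i = a ! i then 0 else 1)"
              using D(2) by simp
          qed
          also have "\<dots> = D * hamming k a"
            unfolding hamming_def lenK[OF k(1)] by (rule sum_distrib_left[symmetric])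
          also have "\<dots> \<le> D * (\<eta> * n)" using k(3) D(1) by (intro mult_left_mono) auto
          also have "\<dots> \<le> \<epsilon> * n" using \<eta>(3) by (simp add: mult.assoc[symmetric] mult_right_mono)
          finally show ?thesis using n(2) by (simp add: dist\<pi>[OF k(1) a(1) x] divide_le_eq)
        qed
        thus "\<pi> k \<in> E'" using k(1) R(7) a by (auto simp: E'_def)
      qed
      moreover have "finite E'" using finite_isometry_group_finite[OF R(1)] by (simp add: E'_def)
      ultimately have "card E \<le> card E'"
        using inj by (metis (no_types, lifting) E_def card_image card_mono inj_on_subset mem_Collect_eq subsetI)
      moreover have "(1 - \<epsilon>) * real (card K) \<le> (1 - \<eta>) * real (card K)"
        using \<eta>(2) by (intro mult_right_mono) auto
      ultimately show "(1 - \<epsilon>) * real (card H) \<le> real (card {h \<in> H. \<exists>b\<in>B. \<forall>x\<in>X. dist (h x) (b x) \<le> \<epsilon>})"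
        using C unfolding E_def[symmetric] E'_def[symmetric] cardH by linarith
    qed
  qed assumption+
qed

section \<open>Towers of finite isometry groups\<close>

lemma group_extensionD:
  assumes "group_extension X G Y H e"
  shows "X \<subseteq> Y" "g \<in> G \<Longrightarrow> e g \<in> H" "g \<in> G \<Longrightarrow> x \<in> X \<Longrightarrow> e g x = g x"
    "g \<in> G \<Longrightarrow> h \<in> G \<Longrightarrow> e (g \<circ> h) = e g \<circ> e h"
  using assms unfolding group_extension_def by blast+

lemma group_extension_inj:
  assumes "finite_isometry_group X G" "group_extension X G Y H e"
  shows "inj_on e G"
proof (rule inj_onI)
  fix g h assume gh: "g \<in> G" "h \<in> G" "e g = e h"
  show "g = h"
  proof
    fix x show "g x = h x"
    proof (cases "x \<in> X")
      case True
      show ?thesis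
        using group_extensionD(3)[OF assms(2) gh(1) True] group_extensionD(3)[OF assms(2) gh(2) True] gh(3)
        by simp
    next
      case False
      thus ?thesis using finite_isometry_groupD(6)[OF assms(1) gh(1)] finite_isometry_groupD(6)[OF assms(1) gh(2)] by simp
    qed
  qed
qed

text \<open>
  One step of the construction: first approximate a prescribed isometry on \<open>F\<close>, then pass to a
  power. The power is taken last, so that the concentration holds for the final group, and it
  keeps the approximation because the embedding extends the action.
\<close>

lemma approximate_and_concentrate:
  fixes X F :: "'u::metric_space set"
  assumes U: "urysohn_space TYPE('u)" and G: "finite_isometry_group X G"
    and nontrivial: "1 < card G" and F: "finite F" and f: "isometric_on F f" and \<epsilon>: "0 < \<epsilon>"
  obtains Y H e where "finite_isometry_group Y H" "group_extension X G Y H e" "F \<subseteq> Y" "card G < card H"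
    "\<exists>h\<in>H. \<forall>x\<in>F. dist (h x) (f x) \<le> \<epsilon>"
    "\<And>B. B \<subseteq> H \<Longrightarrow> \<epsilon> * real (card H) \<le> real (card B) \<Longrightarrow>
       (1 - \<epsilon>) * real (card H) \<le> real (card {h \<in> H. \<exists>b\<in>B. \<forall>x\<in>F. dist (h x) (b x) \<le> \<epsilon>})"
proof -
  define X' where "X' = X \<union> F \<union> f ` F"
  have X': "X \<subseteq> X'" "finite X'" "F \<subseteq> X'" "f ` F \<subseteq> X'"
    using F finite_isometry_groupD(1)[OF G] by (auto simp: X'_def)
  show ?thesis
  proof (rule realize_partial_isometry[OF U G X' f \<epsilon>])
    fix Y1 H1 e1 h1
    assume 1: "finite_isometry_group Y1 H1" "X' \<subseteq> Y1" "group_extension X G Y1 H1 e1"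
      "h1 \<in> H1" "\<And>a. a \<in> F \<Longrightarrow> dist (h1 a) (f a) \<le> \<epsilon>"
    have "e1 ` G \<subseteq> H1" using group_extensionD(2)[OF 1(3)] by blast
    hence "card G \<le> card H1"
      using card_inj_on_le[OF group_extension_inj[OF G 1(3)]] finite_isometry_group_finite[OF 1(1)] by blast
    with nontrivial have card1: "1 < card H1" by simp
    show ?thesis
    proof (rule realize_power[OF U 1(1) card1 \<epsilon>])
      fix Y H e
      assume 2: "finite_isometry_group Y H" "group_extension Y1 H1 Y H e" "card H1 < card H"
        "\<And>B. B \<subseteq> H \<Longrightarrow> \<epsilon> * real (card H) \<le> real (card B) \<Longrightarrow>
           (1 - \<epsilon>) * real (card H) \<le> real (card {h \<in> H. \<exists>b\<in>B. \<forall>x\<in>Y1. dist (h x) (b x) \<le> \<epsilon>})"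
      have F1: "F \<subseteq> Y1" using X' 1(2) by blast
      show ?thesis
      proof (rule that[OF 2(1) group_extension_trans[OF 1(3) 2(2) G]])
        show "F \<subseteq> Y" using F1 group_extensionD(1)[OF 2(2)] by blast
        show "card G < card H" using \<open>card G \<le> card H1\<close> 2(3) by simp
        have e: "e h1 \<in> H" "\<And>x. x \<in> Y1 \<Longrightarrow> e h1 x = h1 x"
          using group_extensionD(2,3)[OF 2(2) 1(4)] .
        show "\<exists>h\<in>H. \<forall>x\<in>F. dist (h x) (f x) \<le> \<epsilon>"
          by (rule bexI[OF _ e(1)]) (use e(2) F1 1(5) in \<open>simp add: subset_iff\<close>)
        fix B assume B: "B \<subseteq> H" "\<epsilon> * real (card H) \<le> real (card B)"
        have "card {h \<in> H. \<exists>b\<in>B. \<forall>x\<in>Y1. dist (h x) (b x) \<le> \<epsilon>} \<le>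
              card {h \<in> H. \<exists>b\<in>B. \<forall>x\<in>F. dist (h x) (b x) \<le> \<epsilon>}"
          using finite_isometry_group_finite[OF 2(1)] F1 by (intro card_mono) auto
        with 2(4)[OF B]
        show "(1 - \<epsilon>) * real (card H) \<le> real (card {h \<in> H. \<exists>b\<in>B. \<forall>x\<in>F. dist (h x) (b x) \<le> \<epsilon>})"
          by linarith
      qed
    qed
  qed
qed

text \<open>
  Powers of the trivial group are trivial, so the construction has to start from a nontrivial one.
\<close>

lemma nontrivial_finite_isometry_group:
  assumes U: "urysohn_space TYPE('u::metric_space)"
  obtains X and G :: "('u::metric_space \<Rightarrow> 'u) set" where "finite_isometry_group X G" "1 < card G"
proof -
  have "\<exists>f :: bool \<Rightarrow> 'u. \<forall>x\<in>UNIV. \<forall>y\<in>UNIV. dist (f x) (f y) = (if x = y then 0 else 1)"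
    by (rule finite_pseudometric_embeds[OF U]) (auto simp: pseudometric_on_def)
  then obtain f :: "bool \<Rightarrow> 'u" where "\<forall>x\<in>UNIV. \<forall>y\<in>UNIV. dist (f x) (f y) = (if x = y then 0 else 1)"
    by (rule exE)
  hence f: "dist (f True) (f False) = 1" by simp
  define a b where "a = f True" and "b = f False"
  have ab: "a \<noteq> b" using f by (auto simp: a_def b_def)
  have "finite_isometry_group {a, b} {id, Transposition.transpose a b}"
    unfolding finite_isometry_group_def
    by (auto simp: isometric_on_def dist_commute transpose_apply_other)
  moreover have "Transposition.transpose a b a \<noteq> id a" using ab by simp
  hence "id \<noteq> Transposition.transpose a b" by metis
  hence "1 < card {id, Transposition.transpose a b}" by simp
  ultimately show ?thesis by (rule that)
qed

lemma isometry_tower_exists: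
  fixes f :: "nat \<Rightarrow> 'u::metric_space \<Rightarrow> 'u" and F :: "nat \<Rightarrow> 'u set" and \<epsilon> :: "nat \<Rightarrow> real"
  assumes U: "urysohn_space TYPE('u)" and F: "\<And>k. finite (F k)"
    and f: "\<And>k. isometric_on (F k) (f k)" and \<epsilon>: "\<And>k. 0 < \<epsilon> k"
  obtains X G e where
    "\<And>k. finite_isometry_group (X k) (G k)"
    "\<And>k. group_extension (X k) (G k) (X (Suc k)) (G (Suc k)) (e k)"
    "\<And>k. F k \<subseteq> X (Suc k)" "\<And>k. card (G k) < card (G (Suc k))"
    "\<And>k. \<exists>h\<in>G (Suc k). \<forall>x\<in>F k. dist (h x) (f k x) \<le> \<epsilon> k"
    "\<And>k B. B \<subseteq> G (Suc k) \<Longrightarrow> \<epsilon> k * real (card (G (Suc k))) \<le> real (card B) \<Longrightarrow>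
       (1 - \<epsilon> k) * real (card (G (Suc k))) \<le>
       real (card {h \<in> G (Suc k). \<exists>b\<in>B. \<forall>x\<in>F k. dist (h x) (b x) \<le> \<epsilon> k})"
proof -
  define P where "P s \<longleftrightarrow> finite_isometry_group (fst s) (snd s) \<and> 1 < card (snd s)"
    for s :: "'u set \<times> ('u \<Rightarrow> 'u) set"
  define Q where "Q k s t \<longleftrightarrow>
      (\<exists>e. group_extension (fst s) (snd s) (fst t) (snd t) e) \<and> F k \<subseteq> fst t \<and> card (snd s) < card (snd t) \<and>
      (\<exists>h\<in>snd t. \<forall>x\<in>F k. dist (h x) (f k x) \<le> \<epsilon> k) \<and>
      (\<forall>B\<subseteq>snd t. \<epsilon> k * real (card (snd t)) \<le> real (card B) \<longrightarrow>
        (1 - \<epsilon> k) * real (card (snd t)) \<le>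
        real (card {h \<in> snd t. \<exists>b\<in>B. \<forall>x\<in>F k. dist (h x) (b x) \<le> \<epsilon> k}))"
    for k :: nat and s t :: "'u set \<times> ('u \<Rightarrow> 'u) set"
  have base: "\<exists>s. P s"
  proof (rule nontrivial_finite_isometry_group[OF U])
    fix X and G :: "('u \<Rightarrow> 'u) set" assume "finite_isometry_group X G" "1 < card G"
    thus "\<exists>s. P s" by (intro exI[of _ "(X, G)"]) (simp add: P_def)
  qed
  have step: "\<exists>t. P t \<and> Q k s t" if "P s" for s k
  proof -
    have s: "finite_isometry_group (fst s) (snd s)" "1 < card (snd s)" using that by (simp_all add: P_def)
    show ?thesis
    proof (rule approximate_and_concentrate[OF U s F f \<epsilon>])
      fix Y H e
      assume *: "finite_isometry_group Y H" "group_extension (fst s) (snd s) Y H e" "F k \<subseteq> Y"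
        "card (snd s) < card H" "\<exists>h\<in>H. \<forall>x\<in>F k. dist (h x) (f k x) \<le> \<epsilon> k"
        "\<And>B. B \<subseteq> H \<Longrightarrow> \<epsilon> k * real (card H) \<le> real (card B) \<Longrightarrow>
           (1 - \<epsilon> k) * real (card H) \<le> real (card {h \<in> H. \<exists>b\<in>B. \<forall>x\<in>F k. dist (h x) (b x) \<le> \<epsilon> k})"
      have "P (Y, H)" using *(1,4) s(2) by (simp add: P_def)
      moreover have "Q k s (Y, H)"
        unfolding Q_def fst_conv snd_conv using *(2-6) by (intro conjI allI impI exI) assumption+
      ultimately show "\<exists>t. P t \<and> Q k s t" by blast
    qed
  qed
  obtain s where s: "\<And>k. P (s k)" "\<And>k. Q k (s k) (s (Suc k))"
    using dependent_nat_choice[of "\<lambda>_. P" Q] base step by blast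
  have "\<forall>k. \<exists>e. group_extension (fst (s k)) (snd (s k)) (fst (s (Suc k))) (snd (s (Suc k))) e"
    using s(2) by (simp add: Q_def)
  then obtain e where e: "\<forall>k. group_extension (fst (s k)) (snd (s k)) (fst (s (Suc k))) (snd (s (Suc k))) (e k)"
    by (rule choice[THEN exE])
  show ?thesis
  proof (rule that[of "\<lambda>k. fst (s k)" "\<lambda>k. snd (s k)" e])
    show "finite_isometry_group (fst (s k)) (snd (s k))" for k using s(1)[of k] by (simp add: P_def)
    show "group_extension (fst (s k)) (snd (s k)) (fst (s (Suc k))) (snd (s (Suc k))) (e k)" for k
      using e by simp
    show "F k \<subseteq> fst (s (Suc k))" "card (snd (s k)) < card (snd (s (Suc k)))"
      "\<exists>h\<in>snd (s (Suc k)). \<forall>x\<in>F k. dist (h x) (f k x) \<le> \<epsilon> k" for k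
      using s(2)[of k] by (simp_all add: Q_def)
    show "(1 - \<epsilon> k) * real (card (snd (s (Suc k)))) \<le>
       real (card {h \<in> snd (s (Suc k)). \<exists>b\<in>B. \<forall>x\<in>F k. dist (h x) (b x) \<le> \<epsilon> k})"
      if "B \<subseteq> snd (s (Suc k))" "\<epsilon> k * real (card (snd (s (Suc k)))) \<le> real (card B)" for k B
      using s(2)[of k] that by (simp add: Q_def)
  qed
qed

lemma isometric_extension_dense:
  fixes f :: "'u::metric_space \<Rightarrow> 'u"
  assumes C: "complete (UNIV :: 'u set)" and D: "closure D = UNIV" and f: "isometric_on D f"
  shows "\<exists>F. isometric_on UNIV F \<and> (\<forall>x\<in>D. F x = f x)"
proof -
  have "\<forall>x. \<exists>s. (\<forall>n. s n \<in> D) \<and> s \<longlonglongrightarrow> x"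
    using D closure_sequential by (metis UNIV_I)
  then obtain s where s: "\<And>x n. s x n \<in> D" "\<And>x. s x \<longlonglongrightarrow> x" by metis
  have "\<exists>l. (\<lambda>n. f (s x n)) \<longlonglongrightarrow> l" for x
  proof -
    have "Cauchy (s x)" using s(2) LIMSEQ_imp_Cauchy by blast
    hence "Cauchy (\<lambda>n. f (s x n))" using isometric_onD[OF f s(1) s(1)] by (simp add: Cauchy_def)
    thus ?thesis using C unfolding complete_def by blast
  qed
  then obtain F where F: "\<And>x. (\<lambda>n. f (s x n)) \<longlonglongrightarrow> F x" by metis
  have "dist (F x) (F y) = dist x y" for x y
  proof (rule LIMSEQ_unique)
    show "(\<lambda>n. dist (f (s x n)) (f (s y n))) \<longlonglongrightarrow> dist (F x) (F y)"
      by (intro tendsto_dist F)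
    show "(\<lambda>n. dist (f (s x n)) (f (s y n))) \<longlonglongrightarrow> dist x y"
      unfolding isometric_onD[OF f s(1) s(1)] by (intro tendsto_dist s(2))
  qed
  moreover have "F x = f x" if x: "x \<in> D" for x
  proof (rule LIMSEQ_unique[OF F])
    have "(\<lambda>n. dist (s x n) x) \<longlonglongrightarrow> 0" using s(2)[of x] by (rule tendsto_dist_iff[THEN iffD1])
    hence "(\<lambda>n. dist (f (s x n)) (f x)) \<longlonglongrightarrow> 0" unfolding isometric_onD[OF f s(1) x] .
    thus "(\<lambda>n. f (s x n)) \<longlonglongrightarrow> f x" by (rule tendsto_dist_iff[THEN iffD2])
  qed
  ultimately show ?thesis by (intro exI[of _ F]) (simp add: isometric_on_def)
qed

lemma isometries_eq_on_dense:
  fixes f g :: "'u::metric_space \<Rightarrow> 'u"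
  assumes D: "closure D = UNIV" and f: "isometric_on UNIV f" and g: "isometric_on UNIV g"
    and eq: "\<And>x. x \<in> D \<Longrightarrow> f x = g x"
  shows "f = g"
proof
  fix x
  have "dist (f x) (g x) \<le> 0 + \<epsilon>" if "0 < \<epsilon>" for \<epsilon>
  proof -
    have "x \<in> closure D" "0 < \<epsilon> / 2" using D that by simp_all
    then obtain a where a: "a \<in> D" "dist a x < \<epsilon> / 2" unfolding closure_approachable by blast
    have "dist (f x) (f a) = dist x a" "dist (g x) (g a) = dist x a"
      using f g by (simp_all add: isometric_on_def)
    moreover have "dist (f x) (g x) \<le> dist (f x) (f a) + dist (g x) (g a)"
      using dist_triangle2[of "f x" "g x" "f a"] eq[OF a(1)] by simp
    ultimately show ?thesis using a(2) by (simp add: dist_commute)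
  qed
  hence "dist (f x) (g x) \<le> 0" by (rule field_le_epsilon)
  thus "f x = g x" by simp
qed

text \<open>
  A coherent tower of finite actions on finite sets with dense union. An element \<open>g\<close> of the \<open>k\<close>-th
  group acts on every later set through the embeddings, and these actions are compatible, hence it
  acts on the dense union and by completeness on the whole space. Extensions from a dense set are
  unique, so this yields an injective homomorphism of the \<open>k\<close>-th group into the isometry group; its
  image is called the \<open>k\<close>-th stage, and the stages form a chain.
\<close>

locale isometry_tower =
  fixes X :: "nat \<Rightarrow> 'u::metric_space set" and G :: "nat \<Rightarrow> ('u \<Rightarrow> 'u) set"
    and e :: "nat \<Rightarrow> ('u \<Rightarrow> 'u) \<Rightarrow> ('u \<Rightarrow> 'u)"
  assumes complete: "complete (UNIV :: 'u set)"
    and dense: "closure (\<Union>k. X k) = UNIV"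
    and grp: "finite_isometry_group (X k) (G k)"
    and extension: "group_extension (X k) (G k) (X (Suc k)) (G (Suc k)) (e k)"
begin

primrec prolong :: "nat \<Rightarrow> nat \<Rightarrow> ('u \<Rightarrow> 'u) \<Rightarrow> ('u \<Rightarrow> 'u)" where
  "prolong k 0 g = g"
| "prolong k (Suc i) g = e (k + i) (prolong k i g)"

lemma prolong_in: "g \<in> G k \<Longrightarrow> prolong k i g \<in> G (k + i)"
  by (induction i) (simp_all add: group_extensionD(2)[OF extension])

lemma prolong_comp: "g \<in> G k \<Longrightarrow> h \<in> G k \<Longrightarrow> prolong k i (g \<circ> h) = prolong k i g \<circ> prolong k i h"
proof (induction i)
  case (Suc i)
  have "e (k + i) (prolong k i g \<circ> prolong k i h) = e (k + i) (prolong k i g) \<circ> e (k + i) (prolong k i h)"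
    by (rule group_extensionD(4)[OF extension prolong_in[OF Suc.prems(1)] prolong_in[OF Suc.prems(2)]])
  thus ?case unfolding prolong.simps Suc.IH[OF Suc.prems] .
qed simp

lemma X_mono: "m \<le> n \<Longrightarrow> X m \<subseteq> X n"
  by (rule lift_Suc_mono_le[of X]) (rule group_extensionD(1)[OF extension])

lemma prolong_stable:
  assumes "g \<in> G k" "x \<in> X (k + i)" "i \<le> j"
  shows "prolong k j g x = prolong k i g x"
  using \<open>i \<le> j\<close>
proof (induction j rule: dec_induct)
  case (step n)
  have "x \<in> X (k + n)" using X_mono[of "k + i" "k + n"] step assms(2) by auto
  hence "e (k + n) (prolong k n g) x = prolong k n g x"
    by (rule group_extensionD(3)[OF extension prolong_in[OF assms(1)]])
  thus ?case using step by simp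
qed simp

lemma prolong_shift: "prolong (Suc k) i (e k g) = prolong k (Suc i) g"
  by (induction i) simp_all

lemma X_covers: "x \<in> (\<Union>k. X k) \<Longrightarrow> \<exists>i. x \<in> X (k + i)"
proof -
  assume "x \<in> (\<Union>k. X k)"
  then obtain i where "x \<in> X i" by blast
  thus ?thesis using X_mono[of i "k + i"] by auto
qed

definition limit_isometry :: "nat \<Rightarrow> ('u \<Rightarrow> 'u) \<Rightarrow> ('u \<Rightarrow> 'u)" where
  "limit_isometry k g =
     (SOME F. isometric_on UNIV F \<and> (\<forall>i. \<forall>x\<in>X (k + i). F x = prolong k i g x))"

lemma limit_isometry:
  assumes g: "g \<in> G k"
  shows "isometric_on UNIV (limit_isometry k g)"
    and "x \<in> X (k + i) \<Longrightarrow> limit_isometry k g x = prolong k i g x"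
proof -
  \<comment> \<open>By stability the least index gives the same value as any other one.\<close>
  define f where "f x = prolong k (LEAST i. x \<in> X (k + i)) g x" for x
  have f: "f x = prolong k i g x" if "x \<in> X (k + i)" for x i
  proof -
    have "x \<in> X (k + (LEAST i. x \<in> X (k + i)))" "(LEAST i. x \<in> X (k + i)) \<le> i"
      using that by (auto intro: LeastI Least_le)
    from prolong_stable[OF g this] show ?thesis by (simp add: f_def)
  qed
  have "isometric_on (\<Union>k. X k) f"
    unfolding isometric_on_def
  proof (intro ballI)
    fix x y assume "x \<in> (\<Union>k. X k)" "y \<in> (\<Union>k. X k)"
    then obtain i j where "x \<in> X (k + i)" "y \<in> X (k + j)" using X_covers[of _ k] by blast
    hence xy: "x \<in> X (k + max i j)" "y \<in> X (k + max i j)"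
      using X_mono[of "k + i" "k + max i j"] X_mono[of "k + j" "k + max i j"] by auto
    show "dist (f x) (f y) = dist x y"
      unfolding f[OF xy(1)] f[OF xy(2)]
      by (rule isometric_onD[OF finite_isometry_groupD(5)[OF grp prolong_in[OF g]] xy])
  qed
  then obtain F where F: "isometric_on UNIV F" "\<forall>x\<in>(\<Union>k. X k). F x = f x"
    using isometric_extension_dense[OF complete dense] by blast
  have "isometric_on UNIV F \<and> (\<forall>i. \<forall>x\<in>X (k + i). F x = prolong k i g x)"
  proof (intro conjI allI ballI)
    fix i x assume x: "x \<in> X (k + i)"
    hence "F x = f x" using F(2) by blast
    thus "F x = prolong k i g x" using f[OF x] by simp
  qed (rule F(1))
  hence *: "isometric_on UNIV (limit_isometry k g) \<and>
      (\<forall>i. \<forall>x\<in>X (k + i). limit_isometry k g x = prolong k i g x)"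
    unfolding limit_isometry_def
    by (rule someI[where P="\<lambda>F. isometric_on UNIV F \<and> (\<forall>i. \<forall>x\<in>X (k + i). F x = prolong k i g x)"])
  show "isometric_on UNIV (limit_isometry k g)" using * by simp
  show "x \<in> X (k + i) \<Longrightarrow> limit_isometry k g x = prolong k i g x" using * by simp
qed

lemma limit_isometry_base: "g \<in> G k \<Longrightarrow> x \<in> X k \<Longrightarrow> limit_isometry k g x = g x"
  using limit_isometry(2)[of g k x 0] by simp

lemma limit_isometry_eqI:
  assumes "g \<in> G k" "isometric_on UNIV F" "\<And>i x. x \<in> X (k + i) \<Longrightarrow> F x = prolong k i g x"
  shows "limit_isometry k g = F"
proof (rule isometries_eq_on_dense[OF dense limit_isometry(1)[OF assms(1)] assms(2)])
  fix x assume "x \<in> (\<Union>k. X k)"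
  then obtain i where "x \<in> X (k + i)" using X_covers by blast
  thus "limit_isometry k g x = F x" using limit_isometry(2)[OF assms(1)] assms(3) by simp
qed

lemma limit_isometry_comp:
  assumes "g \<in> G k" "h \<in> G k"
  shows "limit_isometry k (g \<circ> h) = limit_isometry k g \<circ> limit_isometry k h"
proof (rule limit_isometry_eqI)
  show "g \<circ> h \<in> G k" using finite_isometry_groupD(3)[OF grp assms] .
  show "isometric_on UNIV (limit_isometry k g \<circ> limit_isometry k h)"
    using limit_isometry(1)[OF assms(1)] limit_isometry(1)[OF assms(2)] by (simp add: isometric_on_def)
  fix i x assume x: "x \<in> X (k + i)"
  have "prolong k i h x \<in> X (k + i)"
    using finite_isometry_groupD(4)[OF grp prolong_in[OF assms(2)] x] .
  thus "(limit_isometry k g \<circ> limit_isometry k h) x = prolong k i (g \<circ> h) x"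
    using limit_isometry(2)[OF assms(2) x] limit_isometry(2)[OF assms(1)] prolong_comp[OF assms] by simp
qed

text \<open>
  The extension of the identity is idempotent, and an idempotent isometry is the identity.
\<close>

lemma limit_isometry_id: "limit_isometry k id = id"
proof
  fix x
  have idG: "id \<in> G k" using grp by (rule finite_isometry_groupD)
  let ?F = "limit_isometry k id"
  have "?F (?F x) = ?F x" using limit_isometry_comp[OF idG idG] by (metis comp_apply comp_id)
  moreover have "dist (?F (?F x)) (?F x) = dist (?F x) x"
    using isometric_onD[OF limit_isometry(1)[OF idG]] by simp
  ultimately show "?F x = id x" by simp
qed

lemma limit_isometry_isometries: "g \<in> G k \<Longrightarrow> limit_isometry k g \<in> isometries"
proof -
  assume g: "g \<in> G k"
  obtain h where h: "h \<in> G k" "g \<circ> h = id" using finite_isometry_group_inverse[OF grp g] by blast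
  have "limit_isometry k g \<circ> limit_isometry k h = id"
    using limit_isometry_comp[OF g h(1)] h(2) limit_isometry_id by simp
  hence "surj (limit_isometry k g)" by (metis comp_apply id_apply surjI)
  thus ?thesis using limit_isometry(1)[OF g] by (simp add: isometries_def)
qed

lemma limit_isometry_Suc: "g \<in> G k \<Longrightarrow> limit_isometry (Suc k) (e k g) = limit_isometry k g"
proof (rule limit_isometry_eqI)
  assume g: "g \<in> G k"
  show "e k g \<in> G (Suc k)" using g by (rule group_extensionD(2)[OF extension])
  show "isometric_on UNIV (limit_isometry k g)" using g by (rule limit_isometry)
  show "limit_isometry k g x = prolong (Suc k) i (e k g) x" if "x \<in> X (Suc k + i)" for i x
    using limit_isometry(2)[OF g, of x "Suc i"] that by (simp add: prolong_shift)
qed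

lemma limit_isometry_inj: "inj_on (limit_isometry k) (G k)"
proof (rule inj_onI)
  fix g h assume gh: "g \<in> G k" "h \<in> G k" "limit_isometry k g = limit_isometry k h"
  show "g = h"
  proof
    fix x show "g x = h x"
      using limit_isometry_base[OF gh(1)] limit_isometry_base[OF gh(2)] gh(3)
        finite_isometry_groupD(6)[OF grp gh(1)] finite_isometry_groupD(6)[OF grp gh(2)]
      by (cases "x \<in> X k") metis+
  qed
qed

definition stage :: "nat \<Rightarrow> ('u \<Rightarrow> 'u) set" where
  "stage k = limit_isometry k ` G k"

lemma stage_finite: "finite (stage k)"
  by (simp add: stage_def finite_isometry_group_finite[OF grp])

lemma stage_card: "card (stage k) = card (G k)"
  by (simp add: stage_def card_image[OF limit_isometry_inj])

lemma stage_isometries: "stage k \<subseteq> isometries"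
  by (auto simp: stage_def limit_isometry_isometries)

lemma stage_id: "id \<in> stage k"
  using finite_isometry_groupD(2)[OF grp] limit_isometry_id unfolding stage_def by (metis imageI)

lemma stage_comp:
  assumes "g \<in> stage k" "h \<in> stage k" shows "g \<circ> h \<in> stage k"
proof -
  obtain a b where ab: "g = limit_isometry k a" "a \<in> G k" "h = limit_isometry k b" "b \<in> G k"
    using assms by (auto simp: stage_def)
  have "g \<circ> h = limit_isometry k (a \<circ> b)" using limit_isometry_comp ab by simp
  thus ?thesis using finite_isometry_groupD(3)[OF grp ab(2,4)] unfolding stage_def by blast
qed

lemma stage_inverse:
  assumes "g \<in> stage k" shows "inv_into UNIV g \<in> stage k"
proof -
  obtain a where a: "g = limit_isometry k a" "a \<in> G k" using assms by (auto simp: stage_def)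
  obtain b where b: "b \<in> G k" "a \<circ> b = id" "b \<circ> a = id"
    using finite_isometry_group_inverse[OF grp a(2)] by blast
  have "g \<circ> limit_isometry k b = id" "limit_isometry k b \<circ> g = id"
    using limit_isometry_comp[OF a(2) b(1)] limit_isometry_comp[OF b(1) a(2)] b limit_isometry_id a by simp_all
  hence "inv_into UNIV g = limit_isometry k b" by (simp add: inv_unique_comp)
  thus ?thesis using b(1) by (simp add: stage_def)
qed

lemma stage_Suc: "stage k \<subseteq> stage (Suc k)"
proof
  fix F assume "F \<in> stage k"
  then obtain g where g: "g \<in> G k" "F = limit_isometry k g" by (auto simp: stage_def)
  have "e k g \<in> G (Suc k)" using g(1) by (rule group_extensionD(2)[OF extension])
  thus "F \<in> stage (Suc k)" unfolding stage_def g(2) limit_isometry_Suc[OF g(1), symmetric] by (rule imageI)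
qed

lemma stage_approximates:
  assumes "h \<in> G k" "F \<subseteq> X k" "\<forall>x\<in>F. dist (h x) (f x) \<le> \<epsilon>"
  shows "\<exists>h\<in>stage k. \<forall>x\<in>F. dist (h x) (f x) \<le> \<epsilon>"
proof
  show "limit_isometry k h \<in> stage k" using assms(1) by (simp add: stage_def)
  show "\<forall>x\<in>F. dist (limit_isometry k h x) (f x) \<le> \<epsilon>"
    using assms limit_isometry_base by (auto simp: subset_iff)
qed

lemma stage_concentrates:
  assumes F: "F \<subseteq> X k"
    and conc: "\<And>B. B \<subseteq> G k \<Longrightarrow> \<epsilon> * real (card (G k)) \<le> real (card B) \<Longrightarrow>
       (1 - \<epsilon>) * real (card (G k)) \<le> real (card {h \<in> G k. \<exists>b\<in>B. \<forall>x\<in>F. dist (h x) (b x) \<le> \<epsilon>})"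
    and B: "B \<subseteq> stage k" "\<epsilon> * real (card (stage k)) \<le> real (card B)"
  shows "(1 - \<epsilon>) * real (card (stage k)) \<le>
    real (card {h \<in> stage k. \<exists>b\<in>B. \<forall>x\<in>F. dist (h x) (b x) \<le> \<epsilon>})"
proof -
  let ?L = "limit_isometry k"
  define B' where "B' = {g \<in> G k. ?L g \<in> B}"
  have B': "B' \<subseteq> G k" by (auto simp: B'_def)
  have "?L ` B' = B" using B(1) by (auto simp: B'_def stage_def)
  hence "card B' = card B" using card_image[OF inj_on_subset[OF limit_isometry_inj B']] by simp
  hence "(1 - \<epsilon>) * real (card (G k)) \<le> real (card {h \<in> G k. \<exists>b\<in>B'. \<forall>x\<in>F. dist (h x) (b x) \<le> \<epsilon>})"
    using conc[OF B'] B(2) by (simp add: stage_card)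
  moreover have "card {h \<in> G k. \<exists>b\<in>B'. \<forall>x\<in>F. dist (h x) (b x) \<le> \<epsilon>} \<le>
      card {h \<in> stage k. \<exists>b\<in>B. \<forall>x\<in>F. dist (h x) (b x) \<le> \<epsilon>}" (is "card ?P \<le> card ?Q")
  proof (rule card_inj_on_le)
    show "inj_on ?L ?P" by (rule inj_on_subset[OF limit_isometry_inj]) auto
    show "finite ?Q" using stage_finite by simp
    show "?L ` ?P \<subseteq> ?Q"
    proof (rule image_subsetI)
      fix h assume "h \<in> ?P"
      then obtain b where h: "h \<in> G k" and b: "b \<in> G k" "?L b \<in> B" "\<forall>x\<in>F. dist (h x) (b x) \<le> \<epsilon>"
        by (auto simp: B'_def)
      have "dist (?L h x) (?L b x) \<le> \<epsilon>" if "x \<in> F" for x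
        using limit_isometry_base[OF h] limit_isometry_base[OF b(1)] b(3) that F by auto
      thus "?L h \<in> ?Q" using h b(2) by (auto simp: stage_def)
    qed
  qed
  ultimately show ?thesis unfolding stage_card by linarith
qed

end

text \<open>
  The data for the construction are only used at finitely many points in each step: at step \<open>k\<close>,
  the first points \<open>u 0, \<dots>, u k\<close> are added, the map \<open>f k\<close> is approximated on them, and the new
  group concentrates with respect to the displacement of these points. The initial group of the
  tower carries no such information, hence the shift of the index by one.
\<close>

lemma dense_locally_finite_subgroups:
  fixes u :: "nat \<Rightarrow> 'u::metric_space" and f :: "nat \<Rightarrow> 'u \<Rightarrow> 'u"
  assumes U: "urysohn_space TYPE('u)" and u: "closure (range u) = UNIV" and f: "\<And>k. f k \<in> isometries"
  obtains S where
    "\<And>k. finite (S k)" "\<And>k. S k \<subseteq> isometries" "\<And>k. id \<in> S k"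
    "\<And>k g h. g \<in> S k \<Longrightarrow> h \<in> S k \<Longrightarrow> g \<circ> h \<in> S k" "\<And>k g. g \<in> S k \<Longrightarrow> inv_into UNIV g \<in> S k"
    "\<And>k. S k \<subset> S (Suc k)"
    "\<And>k. \<exists>h\<in>S k. \<forall>i\<le>k. dist (h (u i)) (f k (u i)) \<le> 1 / real (Suc k)"
    "\<And>k B. B \<subseteq> S k \<Longrightarrow> 1 / real (Suc k) * real (card (S k)) \<le> real (card B) \<Longrightarrow>
       (1 - 1 / real (Suc k)) * real (card (S k)) \<le>
       real (card {h \<in> S k. \<exists>b\<in>B. \<forall>i\<le>k. dist (h (u i)) (b (u i)) \<le> 1 / real (Suc k)})"
proof -
  define F where "F k = u ` {..k}" for k
  define \<epsilon> where "\<epsilon> k = 1 / real (Suc k)" for k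
  have F: "finite (F k)" for k by (simp add: F_def)
  have f': "isometric_on (F k) (f k)" for k using f[of k] by (simp add: isometries_def isometric_on_def)
  have \<epsilon>: "0 < \<epsilon> k" for k by (simp add: \<epsilon>_def)
  have F_iff: "(\<forall>x\<in>F k. P x) \<longleftrightarrow> (\<forall>i\<le>k. P (u i))" for k P by (auto simp: F_def)
  show ?thesis
  proof (rule isometry_tower_exists[OF U F f' \<epsilon>])
    fix X G e
    assume T: "\<And>k. finite_isometry_group (X k) (G k)"
    "\<And>k. group_extension (X k) (G k) (X (Suc k)) (G (Suc k)) (e k)"
    "\<And>k. F k \<subseteq> X (Suc k)" "\<And>k. card (G k) < card (G (Suc k))"
    "\<And>k. \<exists>h\<in>G (Suc k). \<forall>x\<in>F k. dist (h x) (f k x) \<le> \<epsilon> k"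
    "\<And>k B. B \<subseteq> G (Suc k) \<Longrightarrow> \<epsilon> k * real (card (G (Suc k))) \<le> real (card B) \<Longrightarrow>
       (1 - \<epsilon> k) * real (card (G (Suc k))) \<le>
       real (card {h \<in> G (Suc k). \<exists>b\<in>B. \<forall>x\<in>F k. dist (h x) (b x) \<le> \<epsilon> k})"
    have "range u \<subseteq> (\<Union>k. X k)" using T(3) by (auto simp: F_def)
    hence "closure (range u) \<subseteq> closure (\<Union>k. X k)" by (rule closure_mono)
    with u have dense: "closure (\<Union>k. X k) = UNIV" by auto
    have "complete (UNIV :: 'u set)" using U by (simp add: urysohn_space_def)
    then interpret isometry_tower X G e
      by unfold_locales (use dense T(1,2) in simp_all)
    show ?thesis
    proof (rule that[of "\<lambda>k. stage (Suc k)"])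
      fix k
      show "finite (stage (Suc k))" "stage (Suc k) \<subseteq> isometries" "id \<in> stage (Suc k)"
        by (rule stage_finite stage_isometries stage_id)+
      show "g \<circ> h \<in> stage (Suc k)" if "g \<in> stage (Suc k)" "h \<in> stage (Suc k)" for g h
        using that by (rule stage_comp)
      show "inv_into UNIV g \<in> stage (Suc k)" if "g \<in> stage (Suc k)" for g
        using that by (rule stage_inverse)
      have "card (stage (Suc k)) \<noteq> card (stage (Suc (Suc k)))"
        unfolding stage_card using T(4)[of "Suc k"] by simp
      thus "stage (Suc k) \<subset> stage (Suc (Suc k))" using stage_Suc[of "Suc k"] by auto
      obtain h where h: "h \<in> G (Suc k)" "\<forall>x\<in>F k. dist (h x) (f k x) \<le> \<epsilon> k" using T(5) by blast
      show "\<exists>h\<in>stage (Suc k). \<forall>i\<le>k. dist (h (u i)) (f k (u i)) \<le> 1 / real (Suc k)"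
        using stage_approximates[OF h(1) T(3) h(2)] unfolding F_iff \<epsilon>_def .
      show "(1 - 1 / real (Suc k)) * real (card (stage (Suc k))) \<le>
        real (card {h \<in> stage (Suc k). \<exists>b\<in>B. \<forall>i\<le>k. dist (h (u i)) (b (u i)) \<le> 1 / real (Suc k)})"
        if "B \<subseteq> stage (Suc k)" "1 / real (Suc k) * real (card (stage (Suc k))) \<le> real (card B)" for B
        using stage_concentrates[OF T(3)[of k] T(6)[of _ k], of B] that unfolding F_iff \<epsilon>_def by simp
    qed
  qed
qed

section \<open>The isometry group and its right-invariant metric\<close>

text \<open>
  The usual notation for inverse functions is occupied by inverses in groups.
\<close>

abbreviation inverse_map :: "('u \<Rightarrow> 'u) \<Rightarrow> 'u \<Rightarrow> 'u" where
  "inverse_map \<equiv> inv_into UNIV"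

lemma isometries_dist: "f \<in> isometries \<Longrightarrow> dist (f x) (f y) = dist x y"
  by (simp add: isometries_def isometric_on_def)

lemma isometries_bij: "f \<in> isometries \<Longrightarrow> bij f"
  unfolding isometries_def bij_def by (auto intro: isometric_on_inj)

lemma isometries_inverse_right: "f \<in> isometries \<Longrightarrow> f (inverse_map f x) = x"
  using isometries_bij bij_is_surj surj_f_inv_f by metis

lemma isometries_inverse_left: "f \<in> isometries \<Longrightarrow> inverse_map f (f x) = x"
  using isometries_bij bij_is_inj inv_f_f by metis

lemma isometries_id: "id \<in> isometries"
  by (simp add: isometries_def isometric_on_def)

lemma isometries_comp: "f \<in> isometries \<Longrightarrow> g \<in> isometries \<Longrightarrow> f \<circ> g \<in> isometries"
  using comp_surj[of g f] by (auto simp: isometries_def isometric_on_def)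

lemma isometries_inverse: "f \<in> isometries \<Longrightarrow> inverse_map f \<in> isometries"
proof -
  assume f: "f \<in> isometries"
  have "dist (inverse_map f x) (inverse_map f y) = dist x y" for x y
    using isometries_dist[OF f, of "inverse_map f x" "inverse_map f y"]
    by (simp add: isometries_inverse_right[OF f])
  moreover have "surj (inverse_map f)"
    using isometries_inverse_left[OF f] by (rule surjI)
  ultimately show ?thesis by (simp add: isometries_def isometric_on_def)
qed

lemma isometries_inverse_comp:
  "f \<in> isometries \<Longrightarrow> g \<in> isometries \<Longrightarrow> inverse_map (f \<circ> g) = inverse_map g \<circ> inverse_map f"
  by (rule o_inv_distrib) (rule isometries_bij; assumption)+

lemma isometries_inverse_inverse: "f \<in> isometries \<Longrightarrow> inverse_map (inverse_map f) = f"
  by (rule inv_inv_eq) (rule isometries_bij)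

lemma carrier_Iso [simp]: "carrier Iso = isometries"
  by (simp add: Iso_def)

lemma mult_Iso [simp]: "monoid.mult Iso f g = f \<circ> g"
  by (simp add: Iso_def)

lemma one_Iso [simp]: "monoid.one Iso = id"
  by (simp add: Iso_def)

lemma group_Iso: "group (Iso :: ('u::metric_space \<Rightarrow> 'u) monoid)"
proof (rule groupI)
  fix f :: "'u \<Rightarrow> 'u" assume "f \<in> carrier Iso"
  hence f: "f \<in> isometries" by simp
  show "\<exists>g\<in>carrier Iso. g \<otimes>\<^bsub>Iso\<^esub> f = \<one>\<^bsub>Iso\<^esub>"
    by (rule bexI[of _ "inverse_map f"])
       (simp_all add: fun_eq_iff isometries_inverse_left f isometries_inverse)
qed (simp_all add: isometries_comp isometries_id o_assoc)

lemma m_inv_Iso: "f \<in> isometries \<Longrightarrow> m_inv Iso f = inverse_map f"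
  by (rule group.inv_equality[OF group_Iso])
     (simp_all add: fun_eq_iff isometries_inverse_left isometries_inverse)

lemma topspace_pointwise: "topspace pointwise_topology = isometries"
  by (simp add: pointwise_topology_def)

lemma continuous_map_pointwise_iff:
  "continuous_map X (pointwise_topology :: ('u::metric_space \<Rightarrow> 'u) topology) h \<longleftrightarrow>
     h ` topspace X \<subseteq> isometries \<and> (\<forall>z. continuous_map X euclidean (\<lambda>x. h x z))"
  unfolding pointwise_topology_def
  by (auto simp: continuous_map_in_subtopology continuous_map_componentwise_UNIV)

lemma continuous_map_evaluation:
  "continuous_map (pointwise_topology :: ('u::metric_space \<Rightarrow> 'u) topology) euclidean (\<lambda>f. f z)"
proof -
  have "continuous_map (pointwise_topology :: ('u \<Rightarrow> 'u) topology) pointwise_topology id"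
    by (rule continuous_map_id)
  thus ?thesis unfolding continuous_map_pointwise_iff by simp
qed

lemma openin_pointwise_ball:
  "openin pointwise_topology {f \<in> isometries. dist (f z) w < (\<epsilon>::real)}"
proof -
  have "openin pointwise_topology {f \<in> topspace pointwise_topology. f z \<in> ball w \<epsilon>}"
    by (rule openin_continuous_map_preimage[OF continuous_map_evaluation]) simp
  thus ?thesis by (simp add: topspace_pointwise dist_commute)
qed

lemma continuous_map_euclidean_iff:
  fixes h :: "'a \<Rightarrow> 'b::metric_space"
  shows "continuous_map X euclidean h \<longleftrightarrow>
    (\<forall>x\<in>topspace X. \<forall>\<epsilon>>0. \<exists>U. openin X U \<and> x \<in> U \<and> (\<forall>y\<in>U. dist (h x) (h y) < \<epsilon>))"
  using Met_TC.continuous_map_to_metric[of X h] by simp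

lemma topological_group_Iso:
  "topological_group (Iso :: ('u::metric_space \<Rightarrow> 'u) monoid) pointwise_topology"
  unfolding topological_group_def
proof (intro conjI)
  let ?T = "pointwise_topology :: ('u \<Rightarrow> 'u) topology"
  show "group (Iso :: ('u \<Rightarrow> 'u) monoid)" by (rule group_Iso)
  show "topspace ?T = carrier Iso" by (simp add: topspace_pointwise)
  show "continuous_map (prod_topology ?T ?T) ?T (\<lambda>(x, y). x \<otimes>\<^bsub>Iso\<^esub> y)"
    unfolding continuous_map_pointwise_iff
  proof (intro conjI allI)
    show "(\<lambda>(x, y). x \<otimes>\<^bsub>Iso\<^esub> y) ` topspace (prod_topology ?T ?T) \<subseteq> isometries"
      by (auto simp: topspace_pointwise isometries_comp)
    fix z
    show "continuous_map (prod_topology ?T ?T) euclidean (\<lambda>x. (case x of (x, y) \<Rightarrow> x \<otimes>\<^bsub>Iso\<^esub> y) z)"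
      unfolding continuous_map_euclidean_iff
    proof (intro ballI allI impI)
      fix p and \<epsilon> :: real assume "p \<in> topspace (prod_topology ?T ?T)" and \<epsilon>: "0 < \<epsilon>"
      then obtain f0 g0 where p: "p = (f0, g0)" "f0 \<in> isometries" "g0 \<in> isometries"
        by (auto simp: topspace_pointwise)
      define A where "A = {f \<in> isometries. dist (f (g0 z)) (f0 (g0 z)) < \<epsilon> / 2}"
      define B where "B = {g \<in> isometries. dist (g z) (g0 z) < \<epsilon> / 2}"
      show "\<exists>W. openin (prod_topology ?T ?T) W \<and> p \<in> W \<and>
          (\<forall>y\<in>W. dist ((case p of (x, y) \<Rightarrow> x \<otimes>\<^bsub>Iso\<^esub> y) z) ((case y of (x, y) \<Rightarrow> x \<otimes>\<^bsub>Iso\<^esub> y) z) < \<epsilon>)"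
      proof (intro exI[of _ "A \<times> B"] conjI ballI)
        show "openin (prod_topology ?T ?T) (A \<times> B)"
          unfolding openin_prod_Times_iff A_def B_def using openin_pointwise_ball by blast
        show "p \<in> A \<times> B" using p \<epsilon> by (simp add: A_def B_def)
        fix q assume "q \<in> A \<times> B"
        then obtain f g where q: "q = (f, g)" "f \<in> isometries" "dist (f (g0 z)) (f0 (g0 z)) < \<epsilon> / 2"
          "dist (g z) (g0 z) < \<epsilon> / 2" by (auto simp: A_def B_def)
        \<comment> \<open>All maps are isometries, so displacements before applying f are preserved.\<close>
        have "dist (f (g z)) (f (g0 z)) < \<epsilon> / 2" using q(4) isometries_dist[OF q(2)] by simp
        with q(3) have "dist (f0 (g0 z)) (f (g z)) < \<epsilon>"
          using dist_triangle[of "f (g z)" "f0 (g0 z)" "f (g0 z)"] by (simp add: dist_commute)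
        thus "dist ((case p of (x, y) \<Rightarrow> x \<otimes>\<^bsub>Iso\<^esub> y) z) ((case q of (x, y) \<Rightarrow> x \<otimes>\<^bsub>Iso\<^esub> y) z) < \<epsilon>"
          by (simp add: p q(1))
      qed
    qed
  qed
  show "continuous_map ?T ?T (\<lambda>x. inv\<^bsub>Iso\<^esub> x)"
    unfolding continuous_map_pointwise_iff
  proof (intro conjI allI)
    show "m_inv Iso ` topspace ?T \<subseteq> isometries"
      by (auto simp: topspace_pointwise m_inv_Iso isometries_inverse)
    fix z
    show "continuous_map ?T euclidean (\<lambda>x. (inv\<^bsub>Iso\<^esub> x) z)"
      unfolding continuous_map_euclidean_iff
    proof (intro ballI allI impI)
      fix f0 :: "'u \<Rightarrow> 'u" and \<epsilon> :: real assume "f0 \<in> topspace ?T" and \<epsilon>: "0 < \<epsilon>"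
      hence f0: "f0 \<in> isometries" by (simp add: topspace_pointwise)
      define y where "y = inverse_map f0 z"
      have y: "f0 y = z" by (simp add: y_def isometries_inverse_right[OF f0])
      show "\<exists>W. openin ?T W \<and> f0 \<in> W \<and> (\<forall>f\<in>W. dist ((inv\<^bsub>Iso\<^esub> f0) z) ((inv\<^bsub>Iso\<^esub> f) z) < \<epsilon>)"
      proof (intro exI[of _ "{f \<in> isometries. dist (f y) z < \<epsilon>}"] conjI ballI)
        show "openin ?T {f \<in> isometries. dist (f y) z < \<epsilon>}" by (rule openin_pointwise_ball)
        show "f0 \<in> {f \<in> isometries. dist (f y) z < \<epsilon>}" using f0 y \<epsilon> by simp
        fix f assume "f \<in> {f \<in> isometries. dist (f y) z < \<epsilon>}"
        hence f: "f \<in> isometries" "dist (f y) z < \<epsilon>" by simp_all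
        have "dist y (inverse_map f z) = dist (f y) z"
          using isometries_dist[OF f(1), of y "inverse_map f z"] by (simp add: isometries_inverse_right[OF f(1)])
        thus "dist ((inv\<^bsub>Iso\<^esub> f0) z) ((inv\<^bsub>Iso\<^esub> f) z) < \<epsilon>"
          using f f0 by (simp add: m_inv_Iso y_def)
      qed
    qed
  qed
qed

text \<open>
  The metric compares the inverses of two isometries on a dense sequence. The inverses are what makes
  it right invariant: \<open>f \<circ> g\<close> has inverse \<open>g\<^sup>-\<^sup>1 \<circ> f\<^sup>-\<^sup>1\<close>, and the outer factor \<open>g\<^sup>-\<^sup>1\<close> is an
  isometry.
\<close>

definition inverse_orbit :: "(nat \<Rightarrow> 'u) \<Rightarrow> ('u \<Rightarrow> 'u) \<Rightarrow> nat \<Rightarrow> 'u" where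
  "inverse_orbit u f = (\<lambda>i. inverse_map f (u i))"

definition orbit_metric :: "(nat \<Rightarrow> 'u::metric_space) \<Rightarrow> ('u \<Rightarrow> 'u) \<Rightarrow> ('u \<Rightarrow> 'u) \<Rightarrow> real" where
  "orbit_metric u f g = dist (inverse_orbit u f) (inverse_orbit u g)"

lemma orbit_metric_space:
  fixes u :: "nat \<Rightarrow> 'u::metric_space"
  assumes u: "closure (range u) = UNIV"
  shows "Metric_space isometries (orbit_metric u)"
proof
  fix f g h :: "'u \<Rightarrow> 'u"
  show "0 \<le> orbit_metric u f g" by (simp add: orbit_metric_def)
  show "orbit_metric u f g = orbit_metric u g f" by (simp add: orbit_metric_def dist_commute)
  show "orbit_metric u f h \<le> orbit_metric u f g + orbit_metric u g h"
    by (simp add: orbit_metric_def dist_triangle)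
  show "orbit_metric u f g = 0 \<longleftrightarrow> f = g" if fg: "f \<in> isometries" "g \<in> isometries"
  proof
    assume "orbit_metric u f g = 0"
    hence "inverse_orbit u f = inverse_orbit u g" by (simp add: orbit_metric_def)
    hence *: "inverse_map f (u i) = inverse_map g (u i)" for i
      unfolding inverse_orbit_def by (rule fun_cong)
    have "inverse_map f = inverse_map g"
    proof (rule isometries_eq_on_dense[OF u])
      show "isometric_on UNIV (inverse_map f)" "isometric_on UNIV (inverse_map g)"
        using isometries_inverse[OF fg(1)] isometries_inverse[OF fg(2)] by (simp_all add: isometries_def)
    qed (use * in auto)
    thus "f = g" using isometries_inverse_inverse fg by metis
  qed (simp add: orbit_metric_def)
qed

text \<open>
  An isometry is determined up to \<open>\<epsilon>\<close> at a point \<open>z\<close> by its inverse at a member of the dense sequence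
  close to the image of \<open>z\<close>; conversely the inverse orbit depends continuously on the isometry, since
  inversion is continuous.
\<close>

lemma orbit_metric_topology:
  fixes u :: "nat \<Rightarrow> 'u::metric_space"
  assumes u: "closure (range u) = UNIV"
  shows "Metric_space.mtopology isometries (orbit_metric u) = pointwise_topology"
proof -
  interpret Metric_space isometries "orbit_metric u" by (rule orbit_metric_space[OF u])
  let ?T = "pointwise_topology :: ('u \<Rightarrow> 'u) topology"
  have top: "topspace ?T = topspace mtopology" by (simp add: topspace_pointwise)
  have "continuous_map mtopology ?T id"
    unfolding continuous_map_pointwise_iff
  proof (intro conjI allI)
    show "id ` topspace mtopology \<subseteq> isometries" by simp
    fix z
    show "continuous_map mtopology euclidean (\<lambda>f. id f z)"
      unfolding mtopology_is_euclidean[symmetric] metric_continuous_map[OF Met_TC.Metric_space_axioms]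
    proof (intro conjI ballI allI impI)
      fix f :: "'u \<Rightarrow> 'u" and \<epsilon> :: real assume f: "f \<in> isometries" and \<epsilon>: "0 < \<epsilon>"
      have "f z \<in> closure (range u)" "0 < \<epsilon> / 3" using u \<epsilon> by simp_all
      then obtain i where i: "dist (u i) (f z) < \<epsilon> / 3"
        unfolding closure_approachable by blast
      have "continuous_on UNIV (\<lambda>a :: nat \<Rightarrow> 'u. a i)" by simp
      then obtain \<delta> where \<delta>: "0 < \<delta>"
        "\<And>b. dist b (inverse_orbit u f) < \<delta> \<Longrightarrow> dist (b i) (inverse_orbit u f i) < \<epsilon> / 3"
        unfolding continuous_on_iff using \<open>0 < \<epsilon> / 3\<close> by (metis UNIV_I)
      show "\<exists>\<delta>>0. \<forall>g. g \<in> isometries \<and> orbit_metric u f g < \<delta> \<longrightarrow> dist (id f z) (id g z) < \<epsilon>"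
      proof (intro exI[of _ \<delta>] conjI allI impI)
        fix g assume "g \<in> isometries \<and> orbit_metric u f g < \<delta>"
        hence g: "g \<in> isometries" "dist (inverse_orbit u g) (inverse_orbit u f) < \<delta>"
          by (simp_all add: orbit_metric_def dist_commute)
        have 1: "dist (inverse_map g (u i)) (inverse_map f (u i)) < \<epsilon> / 3"
          using \<delta>(2)[OF g(2)] by (simp add: inverse_orbit_def)
        have 2: "dist (inverse_map f (u i)) z < \<epsilon> / 3"
          using i isometries_dist[OF f, of "inverse_map f (u i)" z] by (simp add: isometries_inverse_right[OF f])
        have "dist (inverse_map g (u i)) z < \<epsilon> / 3 + \<epsilon> / 3"
          using dist_triangle[of "inverse_map g (u i)" z "inverse_map f (u i)"] 1 2 by linarith
        hence "dist (u i) (g z) < \<epsilon> / 3 + \<epsilon> / 3"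
          using isometries_dist[OF g(1), of "inverse_map g (u i)" z] by (simp add: isometries_inverse_right[OF g(1)])
        thus "dist (id f z) (id g z) < \<epsilon>"
          using i dist_triangle[of "f z" "g z" "u i"] by (simp add: dist_commute)
      qed (rule \<delta>)
    qed simp
  qed
  hence 1: "\<forall>S. openin ?T S \<longrightarrow> openin mtopology S"
    using topology_finer_continuous_id[OF top] by blast
  have "continuous_map ?T euclidean (inverse_orbit u)"
    unfolding euclidean_product_topology[symmetric] continuous_map_componentwise_UNIV
  proof
    fix i
    have "continuous_map ?T ?T (m_inv Iso)"
      using topological_group_Iso unfolding topological_group_def by blast
    hence "continuous_map ?T euclidean (\<lambda>f. m_inv Iso f (u i))"
      unfolding continuous_map_pointwise_iff by simp
    thus "continuous_map ?T euclidean (\<lambda>f. inverse_orbit u f i)"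
      by (rule continuous_map_eq) (simp add: topspace_pointwise m_inv_Iso inverse_orbit_def)
  qed
  hence "continuous_map ?T mtopology id"
    unfolding continuous_map_euclidean_iff continuous_map_to_metric
  proof (intro ballI allI impI)
    fix f :: "'u \<Rightarrow> 'u" and \<epsilon> :: real
    assume c: "\<forall>x\<in>topspace ?T. \<forall>\<epsilon>>0. \<exists>U. openin ?T U \<and> x \<in> U \<and>
      (\<forall>y\<in>U. dist (inverse_orbit u x) (inverse_orbit u y) < \<epsilon>)"
      and f: "f \<in> topspace ?T" and \<epsilon>: "0 < \<epsilon>"
    then obtain U where U: "openin ?T U" "f \<in> U"
      "\<forall>y\<in>U. dist (inverse_orbit u f) (inverse_orbit u y) < \<epsilon>" by blast
    have "U \<subseteq> isometries" using openin_subset[OF U(1)] by (simp add: topspace_pointwise)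
    thus "\<exists>U. openin ?T U \<and> f \<in> U \<and> (\<forall>y\<in>U. id y \<in> mball (id f) \<epsilon>)"
      using U by (intro exI[of _ U]) (auto simp: orbit_metric_def)
  qed
  hence "\<forall>S. openin mtopology S \<longrightarrow> openin ?T S"
    using topology_finer_continuous_id[OF top[symmetric]] by blast
  with 1 show ?thesis by (auto simp: topology_eq)
qed

lemma orbit_metric_right_invariant:
  fixes u :: "nat \<Rightarrow> 'u::metric_space"
  assumes u: "closure (range u) = UNIV"
  shows "right_invariant_compatible_metric (Iso :: ('u \<Rightarrow> 'u) monoid) pointwise_topology (orbit_metric u)"
  unfolding right_invariant_compatible_metric_def
proof (intro conjI ballI)
  show "Metric_space (carrier Iso) (orbit_metric u)" using orbit_metric_space[OF u] by simp
  show "Metric_space.mtopology (carrier Iso) (orbit_metric u) = pointwise_topology"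
    using orbit_metric_topology[OF u] by simp
  fix x y g assume "x \<in> carrier (Iso :: ('u \<Rightarrow> 'u) monoid)" "y \<in> carrier (Iso :: ('u \<Rightarrow> 'u) monoid)"
    "g \<in> carrier (Iso :: ('u \<Rightarrow> 'u) monoid)"
  hence xyg: "x \<in> isometries" "y \<in> isometries" "g \<in> isometries" by simp_all
  show "orbit_metric u (x \<otimes>\<^bsub>Iso\<^esub> g) (y \<otimes>\<^bsub>Iso\<^esub> g) = orbit_metric u x y"
    by (simp add: orbit_metric_def inverse_orbit_def dist_fun_def isometries_inverse_comp xyg
        isometries_dist[OF isometries_inverse[OF xyg(3)]])
qed

text \<open>
  The distance of sequences is a weighted sum, hence controlled by finitely many terms.
\<close>

lemma sequences_close:
  assumes "0 < (\<epsilon>::real)"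
  obtains m where "\<And>a b :: nat \<Rightarrow> 'u::metric_space. (\<And>i. i \<le> m \<Longrightarrow> dist (a i) (b i) \<le> \<epsilon> / 8) \<Longrightarrow> dist a b < \<epsilon>"
proof -
  obtain N where N: "(1 / 2 :: real) ^ N < \<epsilon> / 2"
    using real_arch_pow_inv[of "\<epsilon> / 2" "1 / 2"] assms by auto
  define m where "m = Max ((from_nat :: nat \<Rightarrow> nat) ` {..N})"
  show ?thesis
  proof (rule that)
    fix a b :: "nat \<Rightarrow> 'u" assume ab: "\<And>i. i \<le> m \<Longrightarrow> dist (a i) (b i) \<le> \<epsilon> / 8"
    have "Max {dist (a (from_nat n)) (b (from_nat n)) |n. n \<le> N} \<le> \<epsilon> / 8"
    proof (rule Max.boundedI)
      show "finite {dist (a (from_nat n)) (b (from_nat n)) |n. n \<le> N}" by simp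
      show "{dist (a (from_nat n)) (b (from_nat n)) |n. n \<le> N} \<noteq> {}" by auto
      fix t assume "t \<in> {dist (a (from_nat n)) (b (from_nat n)) |n. n \<le> N}"
      then obtain n where n: "n \<le> N" "t = dist (a (from_nat n)) (b (from_nat n))" by blast
      have "from_nat n \<le> m" unfolding m_def using n(1) by (intro Max_ge) auto
      thus "t \<le> \<epsilon> / 8" using ab n(2) by simp
    qed
    thus "dist a b < \<epsilon>" using dist_fun_le_dist_first_terms[of a b N] N assms by linarith
  qed
qed

lemma dense_sequence:
  assumes "urysohn_space TYPE('u::metric_space)"
  obtains u :: "nat \<Rightarrow> 'u::metric_space" where "closure (range u) = UNIV"
proof -
  obtain C :: "'u set" where C: "countable C" "closure C = UNIV"
    using assms by (auto simp: urysohn_space_def separable_space_def)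
  have "C \<noteq> {}" using C(2) by auto
  hence "range (from_nat_into C) = C" using C(1) by (rule range_from_nat_into)
  with C(2) show ?thesis using that[of "from_nat_into C"] by simp
qed

text \<open>
  Countably many patterns suffice: a finite list \<open>t\<close> of indices and a precision \<open>n\<close> ask for an isometry
  which sends \<open>u i\<close> close to \<open>u (t ! i)\<close>. The third component \<open>j\<close> of the code is a dummy that
  makes every pattern occur infinitely often, hence beyond every given \<open>m\<close>.
\<close>

lemma dense_isometry_sequence:
  fixes u :: "nat \<Rightarrow> 'u::metric_space"
  assumes u: "closure (range u) = UNIV"
  obtains f :: "nat \<Rightarrow> 'u \<Rightarrow> 'u" where "\<And>k. f k \<in> isometries"
    "\<And>g m \<epsilon>. g \<in> isometries \<Longrightarrow> 0 < \<epsilon> \<Longrightarrow> \<exists>k\<ge>m. \<forall>i<m. dist (f k (u i)) (g (u i)) < \<epsilon>"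
proof -
  define P where "P t n f \<longleftrightarrow> f \<in> isometries \<and> (\<forall>i<length t. dist (f (u i)) (u (t ! i)) < 1 / real (Suc n))"
    for t :: "nat list" and n :: nat and f :: "'u \<Rightarrow> 'u"
  define F where "F t n = (if \<exists>f. P t n f then SOME f. P t n f else id)" for t n
  have F: "P t n (F t n)" if "P t n f" for t n f
  proof -
    have "P t n (SOME f. P t n f)" using that by (rule someI[of "P t n"])
    thus ?thesis using that by (auto simp: F_def)
  qed
  have F_iso: "F t n \<in> isometries" for t n
  proof (cases "\<exists>f. P t n f")
    case True
    then obtain f where "P t n f" by blast
    from F[OF this] show ?thesis by (simp add: P_def)
  qed (simp add: F_def isometries_id)
  define f where "f k = (case from_nat k of (t, n, j :: nat) \<Rightarrow> F t n)" for k
  show ?thesis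
  proof (rule that[of f])
    show "f k \<in> isometries" for k by (simp add: f_def F_iso split: prod.split)
    fix g :: "'u \<Rightarrow> 'u" and m :: nat and \<epsilon> :: real assume g: "g \<in> isometries" and \<epsilon>: "0 < \<epsilon>"
    obtain n where n: "1 / real (Suc n) < \<epsilon> / 2"
      using \<epsilon> nat_approx_posE[of "\<epsilon> / 2"] by auto
    have "\<forall>i. \<exists>j. dist (g (u i)) (u j) < 1 / real (Suc n)"
    proof
      fix i
      have "g (u i) \<in> closure (range u)" "0 < 1 / real (Suc n)" using u by simp_all
      thus "\<exists>j. dist (g (u i)) (u j) < 1 / real (Suc n)"
        unfolding closure_approachable by (metis dist_commute rangeE)
    qed
    then obtain s where s: "\<And>i. dist (g (u i)) (u (s i)) < 1 / real (Suc n)" by metis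
    define t where "t = map s [0..<m]"
    have "P t n g" using g s by (simp add: P_def t_def)
    hence Ft: "P t n (F t n)" by (rule F)
    have "inj (\<lambda>j :: nat. to_nat (t, n, j))" by (auto simp: inj_on_def)
    hence "infinite (range (\<lambda>j :: nat. to_nat (t, n, j)))" by (rule range_inj_infinite)
    then obtain k where k: "m \<le> k" "k \<in> range (\<lambda>j :: nat. to_nat (t, n, j))"
      unfolding infinite_nat_iff_unbounded_le by blast
    hence fk: "f k = F t n" by (auto simp: f_def)
    have "dist (f k (u i)) (g (u i)) < \<epsilon>" if "i < m" for i
    proof -
      have "dist (F t n (u i)) (u (s i)) < 1 / real (Suc n)"
        using Ft that by (simp add: P_def t_def)
      thus ?thesis using s[of i] n dist_triangle2[of "F t n (u i)" "g (u i)" "u (s i)"] unfolding fk by linarith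
    qed
    with k(1) show "\<exists>k\<ge>m. \<forall>i<m. dist (f k (u i)) (g (u i)) < \<epsilon>" by blast
  qed
qed

lemma borel_sets_of_finite:
  assumes "finite (topspace T)" "Hausdorff_space T"
  shows "borel_sets_of T = Pow (topspace T)"
proof -
  have "T = discrete_topology (topspace T)"
    using assms by (simp add: finite_t1_space_imp_discrete_topology Hausdorff_imp_t1_space)
  hence "openin T U \<longleftrightarrow> U \<subseteq> topspace T" for U by (metis openin_discrete_topology)
  hence "{U. openin T U} = Pow (topspace T)" by auto
  thus ?thesis unfolding borel_sets_of_def
    using sigma_sets_into_sp[of "Pow (topspace T)" "topspace T"] by (auto intro: sigma_sets.Basic)
qed

section \<open>Finite chains with concentration\<close>

text \<open>
  A finite Hausdorff group is discrete, so every subset is Borel and compact; the counting measure is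
  invariant because translations are injective.
\<close>

lemma uniform_measure_haar:
  assumes S: "finite S" "S \<noteq> {}" "S \<subseteq> isometries" and T: "topspace T = S" "Hausdorff_space T"
    and closed: "\<And>g h. g \<in> S \<Longrightarrow> h \<in> S \<Longrightarrow> g \<circ> h \<in> S"
  shows "normalized_haar_measure (Iso\<lparr>carrier := S\<rparr>) T (uniform_count_measure S)"
  unfolding normalized_haar_measure_def
proof (intro conjI ballI)
  let ?\<mu> = "uniform_count_measure S"
  show "prob_space ?\<mu>" using S by (intro prob_space_uniform_count_measure)
  show "space ?\<mu> = carrier (Iso\<lparr>carrier := S\<rparr>)" by (simp add: space_uniform_count_measure)
  show "sets ?\<mu> = borel_sets_of T"
    using borel_sets_of_finite[of T] S T by (simp add: sets_uniform_count_measure)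
  show "emeasure ?\<mu> (g <#\<^bsub>Iso\<lparr>carrier := S\<rparr>\<^esub> A) = emeasure ?\<mu> A"
    if "g \<in> carrier (Iso\<lparr>carrier := S\<rparr>)" "A \<in> sets ?\<mu>" for g A
  proof -
    have g: "g \<in> S" and A: "A \<subseteq> S" using that by (simp_all add: sets_uniform_count_measure)
    have coset: "g <#\<^bsub>Iso\<lparr>carrier := S\<rparr>\<^esub> A = (\<circ>) g ` A" by (auto simp: l_coset_def)
    have "inj g" using S(3) g isometries_bij bij_is_inj by blast
    hence "inj_on ((\<circ>) g) A" by (auto simp: inj_on_def fun_eq_iff)
    hence "card ((\<circ>) g ` A) = card A" by (rule card_image)
    moreover have "(\<circ>) g ` A \<subseteq> S" using closed g A by blast
    ultimately show ?thesis using S(1) A unfolding coset by (simp add: emeasure_uniform_count_measure)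
  qed
  show "emeasure ?\<mu> A = (SUP C\<in>{C. compactin T C \<and> C \<subseteq> A}. emeasure ?\<mu> C)" if "A \<in> sets ?\<mu>" for A
  proof (rule antisym)
    have A: "A \<subseteq> S" using that by (simp add: sets_uniform_count_measure)
    hence "compactin T A" using S(1) T(1) by (intro finite_imp_compactin) (auto intro: finite_subset)
    thus "emeasure ?\<mu> A \<le> (SUP C\<in>{C. compactin T C \<and> C \<subseteq> A}. emeasure ?\<mu> C)"
      by (intro SUP_upper) simp
    show "(SUP C\<in>{C. compactin T C \<and> C \<subseteq> A}. emeasure ?\<mu> C) \<le> emeasure ?\<mu> A"
      using that by (intro SUP_least emeasure_mono) auto
  qed
qed

lemma liminf_pos_eventually:
  fixes f :: "nat \<Rightarrow> real"
  assumes "0 < liminf (\<lambda>n. ennreal (f n))"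
  obtains c where "0 < c" "\<forall>\<^sub>F n in sequentially. c < f n"
proof -
  obtain y where y: "0 < y" "y < liminf (\<lambda>n. ennreal (f n))" using dense[OF assms] by blast
  have "y < Orderings.top" using y(2) top_greatest by (rule less_le_trans)
  then obtain c where c: "y = ennreal c" "0 \<le> c" by (cases y) auto
  have "0 < c" using y(1) c by simp
  moreover have "\<forall>\<^sub>F n in sequentially. c < f n"
    using less_LiminfD[OF y(2)] by eventually_elim (use c in \<open>simp add: ennreal_less_iff\<close>)
  ultimately show ?thesis by (rule that)
qed

text \<open>
  The hypothesis on \<open>S\<close> speaks of the displacements \<open>h (u i)\<close>, the metric of \<open>h\<^sup>-\<^sup>1 (u i)\<close>. The two are
  matched by applying the hypothesis to the set of inverses of \<open>A n\<close>, which has the same cardinality,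
  and by inverting the neighbourhood it provides. A set whose proportion stays above a constant \<open>c\<close>
  meets the requirement \<open>1 / (n + 1)\<close> for all large \<open>n\<close>.
\<close>

lemma finite_chain_levy_family:
  fixes u :: "nat \<Rightarrow> 'u::metric_space" and S :: "nat \<Rightarrow> ('u \<Rightarrow> 'u) set"
  assumes u: "closure (range u) = UNIV"
    and S: "\<And>k. finite (S k)" "\<And>k. S k \<subseteq> isometries" "\<And>k. id \<in> S k"
    and inverse: "\<And>k g. g \<in> S k \<Longrightarrow> inverse_map g \<in> S k"
    and conc: "\<And>k B. B \<subseteq> S k \<Longrightarrow> 1 / real (Suc k) * real (card (S k)) \<le> real (card B) \<Longrightarrow>
       (1 - 1 / real (Suc k)) * real (card (S k)) \<le>
       real (card {h \<in> S k. \<exists>b\<in>B. \<forall>i\<le>k. dist (h (u i)) (b (u i)) \<le> 1 / real (Suc k)})"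
  shows "levy_family S (\<lambda>_. orbit_metric u) (\<lambda>k. uniform_count_measure (S k))"
  unfolding levy_family_def
proof (intro conjI allI impI)
  interpret Metric_space isometries "orbit_metric u" by (rule orbit_metric_space[OF u])
  have ne: "S k \<noteq> {}" for k using S(3) by blast
  show "mm_space (S k) (orbit_metric u) (uniform_count_measure (S k))" for k
    unfolding mm_space_def
  proof (intro conjI)
    show M: "Metric_space (S k) (orbit_metric u)" using S(2) by (rule subspace)
    show "prob_space (uniform_count_measure (S k))" using S(1) ne by (rule prob_space_uniform_count_measure)
    show "space (uniform_count_measure (S k)) = S k" by (rule space_uniform_count_measure)
    show "sets (uniform_count_measure (S k)) = borel_sets_of (Metric_space.mtopology (S k) (orbit_metric u))"
      using borel_sets_of_finite[OF _ Metric_space.Hausdorff_space_mtopology[OF M]] S(1)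
      by (simp add: sets_uniform_count_measure Metric_space.topspace_mtopology[OF M])
  qed
  fix A and \<epsilon> :: real
  assume "(\<forall>n. A n \<in> sets (uniform_count_measure (S n))) \<and>
      0 < liminf (\<lambda>n. emeasure (uniform_count_measure (S n)) (A n))" and \<epsilon>: "0 < \<epsilon>"
  hence A: "\<And>n. A n \<subseteq> S n" and pos: "0 < liminf (\<lambda>n. emeasure (uniform_count_measure (S n)) (A n))"
    by (simp_all add: sets_uniform_count_measure)
  have lim: "0 < liminf (\<lambda>n. ennreal (card (A n) / card (S n)))"
    using pos by (simp add: emeasure_uniform_count_measure S(1) A)
  obtain c where c: "0 < c" "\<forall>\<^sub>F n in sequentially. c < card (A n) / card (S n)"
    using liminf_pos_eventually[OF lim] by blast
  obtain m where m: "\<And>a b :: nat \<Rightarrow> 'u. (\<And>i. i \<le> m \<Longrightarrow> dist (a i) (b i) \<le> \<epsilon> / 8) \<Longrightarrow> dist a b < \<epsilon>"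
    using sequences_close[OF \<epsilon>] by blast
  have to0: "(\<lambda>n. 1 / real (Suc n)) \<longlonglongrightarrow> 0" using lim_inverse_n' LIMSEQ_Suc by blast
  have "\<forall>\<^sub>F n in sequentially. 1 / real (Suc n) < min c (\<epsilon> / 8)"
    by (rule order_tendstoD(2)[OF to0]) (use c(1) \<epsilon> in simp)
  with c(2) eventually_ge_at_top[of m]
  have lower: "\<forall>\<^sub>F n in sequentially.
      1 - 1 / real (Suc n) \<le> measure (uniform_count_measure (S n)) (nbhd (S n) (orbit_metric u) (A n) \<epsilon>)"
  proof eventually_elim
    fix n assume n: "c < card (A n) / card (S n)" "m \<le> n" "1 / real (Suc n) < min c (\<epsilon> / 8)"
    have card0: "0 < real (card (S n))" using S(1) ne by (simp add: card_gt_0_iff)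
    define B where "B = inverse_map ` A n"
    have BS: "B \<subseteq> S n" using A inverse by (auto simp: B_def)
    have inj: "inj_on inverse_map (S n)"
      by (rule inj_on_inverseI[of _ inverse_map]) (use S(2) isometries_inverse_inverse in blast)
    have "card B = card (A n)" unfolding B_def by (rule card_image[OF inj_on_subset[OF inj A]])
    moreover have "1 / real (Suc n) < card (A n) / card (S n)" using n by linarith
    hence "1 / real (Suc n) * real (card (S n)) \<le> real (card (A n))"
      using card0 by (simp add: field_simps)
    ultimately have *: "(1 - 1 / real (Suc n)) * real (card (S n)) \<le>
       real (card {h \<in> S n. \<exists>b\<in>B. \<forall>i\<le>n. dist (h (u i)) (b (u i)) \<le> 1 / real (Suc n)})"
      (is "_ \<le> real (card ?E)") using conc[OF BS] by simp
    let ?N = "nbhd (S n) (orbit_metric u) (A n) \<epsilon>"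
    have "inverse_map ` ?E \<subseteq> ?N"
    proof (rule image_subsetI)
      fix h assume "h \<in> ?E"
      then obtain a where h: "h \<in> S n" and a: "a \<in> A n"
        "\<forall>i\<le>n. dist (h (u i)) (inverse_map a (u i)) \<le> 1 / real (Suc n)" by (auto simp: B_def)
      have hh: "inverse_map (inverse_map h) = h" using h S(2) isometries_inverse_inverse by blast
      have "dist (inverse_orbit u (inverse_map h)) (inverse_orbit u a) < \<epsilon>"
      proof (rule m)
        fix i assume "i \<le> m"
        hence "dist (h (u i)) (inverse_map a (u i)) \<le> 1 / real (Suc n)" using a(2) n(2) by simp
        thus "dist (inverse_orbit u (inverse_map h) i) (inverse_orbit u a i) \<le> \<epsilon> / 8"
          unfolding inverse_orbit_def hh using n(3) by linarith
      qed
      thus "inverse_map h \<in> ?N" using inverse[OF h] a(1) by (auto simp: nbhd_def orbit_metric_def)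
    qed
    moreover have "finite ?N" using S(1) by (simp add: nbhd_def)
    moreover have "inj_on inverse_map ?E" by (rule inj_on_subset[OF inj]) auto
    ultimately have "card ?E \<le> card ?N" by (intro card_inj_on_le[of inverse_map])
    with * have "(1 - 1 / real (Suc n)) * real (card (S n)) \<le> real (card ?N)" by linarith
    hence "1 - 1 / real (Suc n) \<le> real (card ?N) / real (card (S n))"
      using card0 by (simp add: le_divide_eq)
    also have "\<dots> = measure (uniform_count_measure (S n)) ?N"
      using S(1) by (subst measure_uniform_count_measure) (auto simp: nbhd_def)
    finally show "1 - 1 / real (Suc n) \<le> measure (uniform_count_measure (S n)) ?N" .
  qed
  have "(\<lambda>n. 1 - 1 / real (Suc n)) \<longlonglongrightarrow> 1 - 0" by (intro tendsto_diff tendsto_const to0)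
  hence lo: "(\<lambda>n. 1 - 1 / real (Suc n)) \<longlonglongrightarrow> 1" by simp
  show "(\<lambda>n. measure (uniform_count_measure (S n)) (nbhd (S n) (orbit_metric u) (A n) \<epsilon>)) \<longlonglongrightarrow> 1"
  proof (rule tendsto_sandwich[OF lower _ lo tendsto_const])
    show "\<forall>\<^sub>F n in sequentially.
        measure (uniform_count_measure (S n)) (nbhd (S n) (orbit_metric u) (A n) \<epsilon>) \<le> 1"
      using prob_space.prob_le_1[OF prob_space_uniform_count_measure[OF S(1) ne]] by simp
  qed
qed

text \<open>
  Both approximations, of an isometry by some \<open>f k\<close> and of \<open>f k\<close> by an element of \<open>S k\<close>, are again applied
  to the inverse of the isometry in question.
\<close>

lemma finite_chain_dense:
  fixes u :: "nat \<Rightarrow> 'u::metric_space" and S :: "nat \<Rightarrow> ('u \<Rightarrow> 'u) set"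
  assumes u: "closure (range u) = UNIV"
    and S: "\<And>k. S k \<subseteq> isometries" and inverse: "\<And>k g. g \<in> S k \<Longrightarrow> inverse_map g \<in> S k"
    and f: "\<And>g m \<epsilon>. g \<in> isometries \<Longrightarrow> 0 < \<epsilon> \<Longrightarrow> \<exists>k\<ge>m. \<forall>i<m. dist (f k (u i)) (g (u i)) < \<epsilon>"
    and approx: "\<And>k. \<exists>h\<in>S k. \<forall>i\<le>k. dist (h (u i)) (f k (u i)) \<le> 1 / real (Suc k)"
  shows "pointwise_topology closure_of (\<Union>k. S k) = topspace pointwise_topology"
proof -
  interpret Metric_space isometries "orbit_metric u" by (rule orbit_metric_space[OF u])
  have "\<exists>h\<in>(\<Union>k. S k). h \<in> mball g r" if g: "g \<in> isometries" and r: "0 < r" for g r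
  proof -
    obtain m where m: "\<And>a b :: nat \<Rightarrow> 'u. (\<And>i. i \<le> m \<Longrightarrow> dist (a i) (b i) \<le> r / 8) \<Longrightarrow> dist a b < r"
      using sequences_close[OF r] by blast
    obtain l where l: "1 / real (Suc l) < r / 16"
      using nat_approx_posE[of "r / 16"] r by auto
    obtain k where k: "Suc (max m l) \<le> k" "\<forall>i<Suc (max m l). dist (f k (u i)) (inverse_map g (u i)) < r / 16"
      using f[OF isometries_inverse[OF g], of "r / 16" "Suc (max m l)"] r by auto
    obtain h where h: "h \<in> S k" "\<forall>i\<le>k. dist (h (u i)) (f k (u i)) \<le> 1 / real (Suc k)"
      using approx by blast
    have "1 / real (Suc k) \<le> 1 / real (Suc l)" using k(1) by (intro divide_left_mono) auto
    hence small: "1 / real (Suc k) < r / 16" using l by linarith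
    have hi: "h \<in> isometries" using h(1) S by blast
    have "dist (inverse_orbit u g) (inverse_orbit u (inverse_map h)) < r"
    proof (rule m)
      fix i assume i: "i \<le> m"
      have "dist (f k (u i)) (inverse_map g (u i)) < r / 16" using k(2) i by simp
      moreover have "dist (h (u i)) (f k (u i)) \<le> 1 / real (Suc k)" using h(2) i k(1) by simp
      ultimately have "dist (inverse_map g (u i)) (h (u i)) \<le> r / 8"
        using dist_triangle[of "h (u i)" "inverse_map g (u i)" "f k (u i)"] small
        by (simp add: dist_commute)
      thus "dist (inverse_orbit u g i) (inverse_orbit u (inverse_map h) i) \<le> r / 8"
        by (simp add: inverse_orbit_def isometries_inverse_inverse[OF hi])
    qed
    hence "inverse_map h \<in> mball g r"
      using g isometries_inverse[OF hi] by (simp add: orbit_metric_def)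
    thus ?thesis using inverse[OF h(1)] by blast
  qed
  hence "mtopology closure_of (\<Union>k. S k) = isometries" unfolding metric_closure_of by auto
  thus ?thesis by (simp add: orbit_metric_topology[OF u] topspace_pointwise)
qed

theorem theorem2p13:
  assumes "urysohn_space TYPE('u::metric_space)"
  shows "levy_group (Iso :: ('u \<Rightarrow> 'u) monoid) pointwise_topology \<and>
         (\<exists>H. levy_chain (Iso :: ('u \<Rightarrow> 'u) monoid) pointwise_topology H \<and> (\<forall>n. finite (H n)))"
proof -
  let ?I = "Iso :: ('u \<Rightarrow> 'u) monoid"
  let ?T = "pointwise_topology :: ('u \<Rightarrow> 'u) topology"
  obtain u :: "nat \<Rightarrow> 'u" where u: "closure (range u) = UNIV" using dense_sequence[OF assms] by blast
  interpret Metric_space isometries "orbit_metric u" by (rule orbit_metric_space[OF u])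
  have T: "mtopology = ?T" by (rule orbit_metric_topology[OF u])
  have metrizable: "metrizable_space ?T" and Hausdorff: "Hausdorff_space ?T"
    using metrizable_space_mtopology Hausdorff_space_mtopology unfolding T by simp_all
  have "\<exists>H. levy_chain ?I ?T H \<and> (\<forall>n. finite (H n))"
  proof (rule dense_isometry_sequence[OF u])
    fix f :: "nat \<Rightarrow> 'u \<Rightarrow> 'u"
    assume f: "\<And>k. f k \<in> isometries"
      "\<And>g m \<epsilon>. g \<in> isometries \<Longrightarrow> 0 < \<epsilon> \<Longrightarrow> \<exists>k\<ge>m. \<forall>i<m. dist (f k (u i)) (g (u i)) < \<epsilon>"
    show ?thesis
    proof (rule dense_locally_finite_subgroups[OF assms u f(1)])
      fix S :: "nat \<Rightarrow> ('u \<Rightarrow> 'u) set"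
      assume S: "\<And>k. finite (S k)" "\<And>k. S k \<subseteq> isometries" "\<And>k. id \<in> S k"
        "\<And>k g h. g \<in> S k \<Longrightarrow> h \<in> S k \<Longrightarrow> g \<circ> h \<in> S k" "\<And>k g. g \<in> S k \<Longrightarrow> inverse_map g \<in> S k"
        "\<And>k. S k \<subset> S (Suc k)"
        "\<And>k. \<exists>h\<in>S k. \<forall>i\<le>k. dist (h (u i)) (f k (u i)) \<le> 1 / real (Suc k)"
        "\<And>k B. B \<subseteq> S k \<Longrightarrow> 1 / real (Suc k) * real (card (S k)) \<le> real (card B) \<Longrightarrow>
           (1 - 1 / real (Suc k)) * real (card (S k)) \<le>
           real (card {h \<in> S k. \<exists>b\<in>B. \<forall>i\<le>k. dist (h (u i)) (b (u i)) \<le> 1 / real (Suc k)})"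
      have sub: "subgroup (S k) ?I" for k
      proof (rule group.subgroupI[OF group_Iso])
        show "S k \<subseteq> carrier ?I" using S(2) by simp
        show "S k \<noteq> {}" using S(3) by blast
        show "inv\<^bsub>?I\<^esub> g \<in> S k" if "g \<in> S k" for g
          using S(5)[OF that] S(2)[of k] that by (simp add: m_inv_Iso subset_iff)
        show "g \<otimes>\<^bsub>?I\<^esub> h \<in> S k" if "g \<in> S k" "h \<in> S k" for g h using S(4)[OF that] by simp
      qed
      have compact: "compactin ?T (S k)" for k
        by (rule finite_imp_compactin) (simp_all add: S(1,2) topspace_pointwise)
      have haar: "normalized_haar_measure (?I\<lparr>carrier := S k\<rparr>) (subtopology ?T (S k))
          (uniform_count_measure (S k))" for k
      proof (rule uniform_measure_haar[OF S(1) _ S(2)])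
        show "S k \<noteq> {}" using S(3) by blast
        show "topspace (subtopology ?T (S k)) = S k" using S(2)[of k] by (auto simp: topspace_pointwise)
        show "Hausdorff_space (subtopology ?T (S k))" using Hausdorff by (rule Hausdorff_space_subtopology)
      qed (rule S(4))
      have "levy_chain ?I ?T S"
        unfolding levy_chain_def
      proof (intro conjI allI exI)
        show "subgroup (S k) ?I" "compactin ?T (S k)" "S k \<subset> S (Suc k)" for k
          by (rule sub compact S(6))+
        show "?T closure_of (\<Union>k. S k) = topspace ?T"
          by (rule finite_chain_dense[OF u S(2,5) f(2) S(7)])
        show "right_invariant_compatible_metric ?I ?T (orbit_metric u)"
          by (rule orbit_metric_right_invariant[OF u])
        show "normalized_haar_measure (?I\<lparr>carrier := S k\<rparr>) (subtopology ?T (S k))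
          (uniform_count_measure (S k))" for k by (rule haar)
        show "levy_family S (\<lambda>_. orbit_metric u) (\<lambda>k. uniform_count_measure (S k))"
          by (rule finite_chain_levy_family[OF u S(1-3,5,8)])
      qed
      with S(1) show ?thesis by blast
    qed
  qed
  thus ?thesis using topological_group_Iso metrizable unfolding levy_group_def by blast
qed

end
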